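(* Let $(W,S)$ be an irreducible affine Coxeter system with set of reflections $T$ and let $x\in W$. Then $x$ is a proper parabolic quasi-Coxeter element if and only if there exists a quasi-Coxeter element $w\in W$ such that $x\leq_T w$ and $P(x)\neq W$. Equivalently, $x$ is a proper parabolic quasi-Coxeter element if and only if there exists a quasi-Coxeter element $w\in W$ such that $x\leq_T w$ and $x$ is elliptic.
   Context: Irreducible affine Coxeter system: for an irreducible crystallographic root system $\Phi$ in a Euclidean space $V$ with simple system $\Delta$ and highest root $\widetilde\alpha$, let $s_{\alpha,k}:V\to V$, $v\mapsto v-((v\mid\alpha)-k)\alpha^\vee$ with $\alpha^\vee=2\alpha/(\alpha\mid\alpha)$ ($\alpha\in\Phi$, $k\in\mathbb{Z}$); then $W=\langle s_{\alpha,k}\mid\alpha\in\Phi,k\in\mathbb{Z}\rangle$, $S=\{s_{\alpha,0}\mid\alpha\in\Delta\}\cup\{s_{\widetilde\alpha,1}\}$, and the set of reflections is $T=\{wsw^{-1}\mid w\in W,s\in S\}=\{s_{\alpha,k}\mid \alpha\in\Phi,k\in\mathbb{Z}\}$. The rank is $|S|$. The reflection length $\ell_T(w)$ is the smallest $m$ such that $w$ is a product of $m$ elements of $T$; a factorization $w=t_1\cdots t_m$ with $t_i\in T$ and $m=\ell_T(w)$ is called a reduced reflection factorization. The absolute order $\leq_T$ is defined by $u\leq_T v$ if and only if $\ell_T(u)+\ell_T(u^{-1}v)=\ell_T(v)$. A parabolic subgroup of $W$ is a subgroup $wW_Iw^{-1}$ with $w\in W$, $I\subseteq S$, $W_I=\langle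 I\rangle$; it is a Coxeter group with simple reflections $wIw^{-1}$ and rank $|I|$. The parabolic closure $P(x)$ is the intersection of all parabolic subgroups containing $x$ (itself a parabolic subgroup). An element of a Coxeter group of rank $n$ is a quasi-Coxeter element if it admits a reduced reflection factorization with $n$ factors which generate the group. An element of $W$ is a proper parabolic quasi-Coxeter element if it is a quasi-Coxeter element of some proper parabolic subgroup of $W$. An element of $W$ is elliptic if it has finite order. *)

theory Defs
  imports "HOL-Analysis.Analysis" "HOL-Algebra.Algebra"
begin

section \<open>Reflections and quasi-Coxeter elements relative to a group with simple reflections\<close>

text \<open>
  The definitions below take a group \<open>G\<close> and a set \<open>S\<close> of simple reflections of \<open>G\<close>; they are
  used both for the affine group itself and for its parabolic subgroups.
\<close>

definition conj_set :: "('g, 'm) monoid_scheme \<Rightarrow> 'g \<Rightarrow> 'g set \<Rightarrow> 'g set" where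
  "conj_set G w A = (w <#\<^bsub>G\<^esub> A) #>\<^bsub>G\<^esub> inv\<^bsub>G\<^esub> w"

definition reflections :: "('g, 'm) monoid_scheme \<Rightarrow> 'g set \<Rightarrow> 'g set" where
  "reflections G S = {w \<otimes>\<^bsub>G\<^esub> s \<otimes>\<^bsub>G\<^esub> inv\<^bsub>G\<^esub> w | w s. w \<in> carrier G \<and> s \<in> S}"

definition reflection_factorization ::
    "('g, 'm) monoid_scheme \<Rightarrow> 'g set \<Rightarrow> 'g \<Rightarrow> 'g list \<Rightarrow> bool" where
  "reflection_factorization G S w ts \<longleftrightarrow>
     set ts \<subseteq> reflections G S \<and> foldr (\<otimes>\<^bsub>G\<^esub>) ts \<one>\<^bsub>G\<^esub> = w"

definition reflection_length :: "('g, 'm) monoid_scheme \<Rightarrow> 'g set \<Rightarrow> 'g \<Rightarrow> nat" where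
  "reflection_length G S w = (LEAST m. \<exists>ts. reflection_factorization G S w ts \<and> length ts = m)"

definition reduced_reflection_factorization ::
    "('g, 'm) monoid_scheme \<Rightarrow> 'g set \<Rightarrow> 'g \<Rightarrow> 'g list \<Rightarrow> bool" where
  "reduced_reflection_factorization G S w ts \<longleftrightarrow>
     reflection_factorization G S w ts \<and> length ts = reflection_length G S w"

definition absolute_le :: "('g, 'm) monoid_scheme \<Rightarrow> 'g set \<Rightarrow> 'g \<Rightarrow> 'g \<Rightarrow> bool" where
  "absolute_le G S u v \<longleftrightarrow>
     reflection_length G S u + reflection_length G S (inv\<^bsub>G\<^esub> u \<otimes>\<^bsub>G\<^esub> v) = reflection_length G S v"

definition quasi_Coxeter :: "('g, 'm) monoid_scheme \<Rightarrow> 'g set \<Rightarrow> 'g \<Rightarrow> bool" where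
  "quasi_Coxeter G S w \<longleftrightarrow>
     w \<in> carrier G \<and>
     (\<exists>ts. reduced_reflection_factorization G S w ts \<and> length ts = card S \<and>
           generate G (set ts) = carrier G)"

definition parabolic_subgroup :: "('g, 'm) monoid_scheme \<Rightarrow> 'g set \<Rightarrow> 'g set \<Rightarrow> bool" where
  "parabolic_subgroup G S P \<longleftrightarrow>
     (\<exists>w\<in>carrier G. \<exists>I\<subseteq>S. P = conj_set G w (generate G I))"

definition parabolic_closure :: "('g, 'm) monoid_scheme \<Rightarrow> 'g set \<Rightarrow> 'g \<Rightarrow> 'g set" where
  "parabolic_closure G S x = \<Inter>{P. parabolic_subgroup G S P \<and> x \<in> P}"

text \<open>
  The parabolic subgroup \<open>w W\<^sub>I w\<inverse>\<close> is regarded as a Coxeter group with simple reflections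
  \<open>w I w\<inverse>\<close>: its reflections, reflection length and rank are the ones of this smaller system.
\<close>

definition proper_parabolic_quasi_Coxeter ::
    "('g, 'm) monoid_scheme \<Rightarrow> 'g set \<Rightarrow> 'g \<Rightarrow> bool" where
  "proper_parabolic_quasi_Coxeter G S x \<longleftrightarrow>
     (\<exists>w\<in>carrier G. \<exists>I\<subseteq>S.
        conj_set G w (generate G I) \<noteq> carrier G \<and>
        quasi_Coxeter (G\<lparr>carrier := conj_set G w (generate G I)\<rparr>) (conj_set G w I) x)"

definition elliptic :: "('g, 'm) monoid_scheme \<Rightarrow> 'g \<Rightarrow> bool" where
  "elliptic G x \<longleftrightarrow> (\<exists>n::nat. n > 0 \<and> x [^]\<^bsub>G\<^esub> n = \<one>\<^bsub>G\<^esub>)"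


section \<open>Root systems and irreducible affine Coxeter systems\<close>

definition coroot :: "'a::euclidean_space \<Rightarrow> 'a" where
  "coroot \<alpha> = (2 / (\<alpha> \<bullet> \<alpha>)) *\<^sub>R \<alpha>"

definition affine_reflection :: "'a::euclidean_space \<Rightarrow> int \<Rightarrow> 'a \<Rightarrow> 'a" where
  "affine_reflection \<alpha> k v = v - (v \<bullet> \<alpha> - of_int k) *\<^sub>R coroot \<alpha>"

text \<open>Root systems are reduced and span the ambient space.\<close>

definition crystallographic_root_system :: "'a::euclidean_space set \<Rightarrow> bool" where
  "crystallographic_root_system \<Phi> \<longleftrightarrow>
     finite \<Phi> \<and> 0 \<notin> \<Phi> \<and> span \<Phi> = UNIV \<and>
     (\<forall>\<alpha>\<in>\<Phi>. \<forall>c::real. c *\<^sub>R \<alpha> \<in> \<Phi> \<longleftrightarrow> c = 1 \<or> c = -1) \<and>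
     (\<forall>\<alpha>\<in>\<Phi>. affine_reflection \<alpha> 0 ` \<Phi> = \<Phi>) \<and>
     (\<forall>\<alpha>\<in>\<Phi>. \<forall>\<beta>\<in>\<Phi>. \<beta> \<bullet> coroot \<alpha> \<in> \<int>)"

definition irreducible_root_system :: "'a::euclidean_space set \<Rightarrow> bool" where
  "irreducible_root_system \<Phi> \<longleftrightarrow>
     \<Phi> \<noteq> {} \<and>
     \<not> (\<exists>\<Phi>1 \<Phi>2. \<Phi>1 \<noteq> {} \<and> \<Phi>2 \<noteq> {} \<and> \<Phi>1 \<union> \<Phi>2 = \<Phi> \<and> \<Phi>1 \<inter> \<Phi>2 = {} \<and>
                (\<forall>\<alpha>\<in>\<Phi>1. \<forall>\<beta>\<in>\<Phi>2. \<alpha> \<bullet> \<beta> = 0))"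

definition nonneg_combination :: "'a::euclidean_space set \<Rightarrow> 'a \<Rightarrow> bool" where
  "nonneg_combination \<Delta> v \<longleftrightarrow> (\<exists>c::'a \<Rightarrow> nat. v = (\<Sum>\<alpha>\<in>\<Delta>. of_nat (c \<alpha>) *\<^sub>R \<alpha>))"

definition simple_system :: "'a::euclidean_space set \<Rightarrow> 'a set \<Rightarrow> bool" where
  "simple_system \<Phi> \<Delta> \<longleftrightarrow>
     \<Delta> \<subseteq> \<Phi> \<and> independent \<Delta> \<and> span \<Delta> = span \<Phi> \<and>
     (\<forall>\<beta>\<in>\<Phi>. nonneg_combination \<Delta> \<beta> \<or> nonneg_combination \<Delta> (- \<beta>))"

definition highest_root :: "'a::euclidean_space set \<Rightarrow> 'a set \<Rightarrow> 'a \<Rightarrow> bool" where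
  "highest_root \<Phi> \<Delta> \<theta> \<longleftrightarrow> \<theta> \<in> \<Phi> \<and> (\<forall>\<beta>\<in>\<Phi>. nonneg_combination \<Delta> (\<theta> - \<beta>))"

text \<open>Multiplication in \<open>BijGroup UNIV\<close> is composition of maps.\<close>

definition affine_Weyl_group :: "'a::euclidean_space set \<Rightarrow> ('a \<Rightarrow> 'a) monoid" where
  "affine_Weyl_group \<Phi> =
     (BijGroup UNIV)\<lparr>carrier :=
        generate (BijGroup UNIV) {affine_reflection \<alpha> k | \<alpha> k. \<alpha> \<in> \<Phi>}\<rparr>"

definition affine_simple_reflections :: "'a::euclidean_space set \<Rightarrow> 'a \<Rightarrow> ('a \<Rightarrow> 'a) set" where
  "affine_simple_reflections \<Delta> \<theta> =
     {affine_reflection \<alpha> 0 | \<alpha>. \<alpha> \<in> \<Delta>} \<union> {affine_reflection \<theta> 1}"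

definition irreducible_affine_Coxeter_system ::
    "('a::euclidean_space \<Rightarrow> 'a) monoid \<Rightarrow> ('a \<Rightarrow> 'a) set \<Rightarrow> bool" where
  "irreducible_affine_Coxeter_system W S \<longleftrightarrow>
     (\<exists>\<Phi> \<Delta> \<theta>. crystallographic_root_system \<Phi> \<and> irreducible_root_system \<Phi> \<and>
        simple_system \<Phi> \<Delta> \<and> highest_root \<Phi> \<Delta> \<theta> \<and>
        W = affine_Weyl_group \<Phi> \<and> S = affine_simple_reflections \<Delta> \<theta>)"

end

theory Submission
  imports Defs
begin

text \<open>
  An affine root is a vector \<open>y = (\<alpha>, k)\<close>, read as the affine function \<open>v \<mapsto> v \<bullet> \<alpha> - k\<close>. There are
  \<open>n + 1\<close> simple affine roots, where \<open>n\<close> is the dimension of the Euclidean space, and they form a basis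
  of the space of pairs. All lengths are controlled by one observation: every quadratic function
  \<open>quadratic h\<close> (a multiple of the squared norm plus a linear form) changes under the reflection
  in \<open>y\<close> by \<open>- (h \<bullet> acoroot y)\<close> times the affine function \<open>y\<close>. Hence composing it with a word changes it by a
  combination of the roots of the word (\<open>quadratic_word_map\<close>), and this combination depends only on the
  element that the word represents. Two consequences carry the theorem.

  A word in linearly independent roots that span the space of pairs cannot equal a word whose roots do
  not span (\<open>independent_word_spans\<close>); so a product of \<open>n + 1\<close> reflections that generate the
  group has reflection length \<open>n + 1\<close>. If \<open>x\<close> is quasi-Coxeter in \<open>w W\<^sub>I w\<inverse>\<close>, then \<open>x\<close>
  times the conjugates of the remaining simple reflections is such a product. This is a quasi-Coxeter
  element above \<open>x\<close>. A proper parabolic subgroup fixes a point, which makes \<open>x\<close> elliptic.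

  Conversely let \<open>x\<close> lie below a quasi-Coxeter element \<open>w\<close> and fix a point. A reduced factorization of
  \<open>x\<close> extends to one of \<open>w\<close>. The roots of a generating factorization of \<open>w\<close> span the lattice of affine
  roots, and their coroots span the lattice of affine coroots, because every reflection of a group is
  conjugate to one of any set of reflections that generates it (\<open>R_subset_orbit_if_generating\<close>).
  Comparing coefficients in the identity for quadratic functions transfers this to every factorization of
  \<open>w\<close> with \<open>n + 1\<close> factors (\<open>zspan_transfer\<close>). So a root
  that is a linear combination of the roots of \<open>x\<close> is an integral combination of them, and likewise for
  the coroots, and a descent on the coefficients shows that its reflection lies in the group generated
  by the factors of \<open>x\<close> (\<open>in_orbit_if_integral\<close>). These factors fix every fixed point of \<open>x\<close>,
  hence they generate the fixator of a generic fixed point. The fixator is conjugate to a standard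
  parabolic subgroup: a distance descent moves the point into the closed alcove and shows that
  fixators of points there are generated by simple reflections (\<open>in_orbit_of_walls\<close>).
\<close>

section \<open>Affine roots and words in their reflections\<close>

definition aval :: "'a::euclidean_space \<times> real \<Rightarrow> 'a \<Rightarrow> real" where
  "aval x v = v \<bullet> fst x - snd x"

text \<open>
  The factor makes \<open>arefl\<close> below the reflection in the zero set of \<open>aval x\<close>, and \<open>acoroot\<close> an involution,
  so that statements about roots apply verbatim to coroots.
\<close>

definition acoroot :: "'a::euclidean_space \<times> real \<Rightarrow> 'a \<times> real" where
  "acoroot x = (2 / (fst x \<bullet> fst x)) *\<^sub>R x"

definition cartan :: "'a::euclidean_space \<times> real \<Rightarrow> 'a \<times> real \<Rightarrow> real" where
  "cartan x y = fst x \<bullet> fst (acoroot y)"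

definition arefl :: "'a::euclidean_space \<times> real \<Rightarrow> 'a \<Rightarrow> 'a" where
  "arefl x v = v - aval x v *\<^sub>R fst (acoroot x)"

definition root_refl :: "'a::euclidean_space \<times> real \<Rightarrow> 'a \<times> real \<Rightarrow> 'a \<times> real" where
  "root_refl y x = x - cartan x y *\<^sub>R y"

lemma affine_reflection_eq_refl: "affine_reflection \<alpha> k = arefl (\<alpha>, of_int k)"
  by (auto simp: fun_eq_iff affine_reflection_def arefl_def aval_def acoroot_def coroot_def)

lemma aval_add: "aval (x + y) v = aval x v + aval y v"
  and aval_diff: "aval (x - y) v = aval x v - aval y v"
  and aval_scaleR: "aval (c *\<^sub>R x) v = c * aval x v"
  and aval_minus: "aval (- x) v = - aval x v"
  and aval_zero: "aval 0 v = 0"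
  by (auto simp: aval_def inner_add_right inner_diff_right algebra_simps)

lemma aval_sum: "aval (\<Sum>i\<in>A. f i) v = (\<Sum>i\<in>A. aval (f i) v)"
  by (induction A rule: infinite_finite_induct) (auto simp: aval_add aval_zero)

text \<open>
  A pair is recovered from its affine function, so identities between pairs can be checked pointwise.
\<close>

lemma aval_inject: assumes "aval x = aval y" shows "x = y"
proof -
  have s: "snd x = snd y" using fun_cong[OF assms, of 0] by (simp add: aval_def)
  have "v \<bullet> fst x = v \<bullet> fst y" for v using fun_cong[OF assms, of v] s by (simp add: aval_def)
  then have "fst x = fst y" by (metis vector_eq_rdot inner_commute)
  with s show ?thesis by (simp add: prod_eq_iff)
qed

lemma aval_refl: "aval x (arefl y v) = aval (root_refl y x) v"
  by (simp add: aval_def arefl_def root_refl_def cartan_def inner_diff_left inner_diff_right inner_commute algebra_simps)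

lemma cartan_self: "fst y \<noteq> 0 \<Longrightarrow> cartan y y = 2"
  by (simp add: cartan_def acoroot_def)

lemma root_refl_self: "fst y \<noteq> 0 \<Longrightarrow> root_refl y y = - y"
  by (simp add: root_refl_def cartan_self) (metis add_diff_cancel_left' minus_diff_eq scaleR_2)

lemma cartan_linear: "cartan (x + z) y = cartan x y + cartan z y" "cartan (x - z) y = cartan x y - cartan z y" "cartan (c *\<^sub>R x) y = c * cartan x y"
  "cartan (- x) y = - cartan x y" "cartan 0 y = 0"
  by (auto simp: cartan_def inner_add_left inner_diff_left)

lemma linear_root_refl: "linear (root_refl y)"
  by (rule linearI) (auto simp: root_refl_def cartan_linear algebra_simps)

lemma root_refl_involution: "fst y \<noteq> 0 \<Longrightarrow> root_refl y (root_refl y x) = x"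
  by (simp add: root_refl_def cartan_linear cartan_self)

lemma arefl_involution: assumes "fst y \<noteq> 0" shows "arefl y (arefl y v) = v"
proof -
  have "aval y (arefl y v) = - aval y v" using assms by (simp add: aval_refl root_refl_self aval_minus)
  then show ?thesis unfolding arefl_def[of y "arefl y v"] by (simp add: arefl_def)
qed

lemma root_refl_inner:
  assumes "fst y \<noteq> 0" shows "fst (root_refl y x) \<bullet> fst (root_refl y z) = fst x \<bullet> fst z"
proof -
  have "(fst y \<bullet> fst y) \<noteq> 0" using assms by simp
  then show ?thesis
    by (simp add: root_refl_def cartan_def acoroot_def inner_diff_left inner_diff_right inner_commute field_simps)
qed

lemma acoroot_root_refl: "fst y \<noteq> 0 \<Longrightarrow> acoroot (root_refl y x) = root_refl y (acoroot x)"
  by (simp add: acoroot_def root_refl_inner linear_cmul[OF linear_root_refl])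

text \<open>
  The affine function \<open>aval x\<close> is transported by the isometry \<open>arefl y\<close> to \<open>aval (root_refl y x)\<close>.
\<close>

lemma arefl_conj:
  assumes "fst y \<noteq> 0"
  shows "arefl y (arefl x (arefl y v)) = arefl (root_refl y x) v"
proof -
  let ?u = "arefl y v" let ?c = "aval x ?u"
  have "arefl y (?u - ?c *\<^sub>R fst (acoroot x)) = arefl y ?u - ?c *\<^sub>R (fst (acoroot x) - cartan (acoroot x) y *\<^sub>R fst y)"
    by (simp add: arefl_def aval_def cartan_def inner_diff_left algebra_simps acoroot_def)
  also have "arefl y ?u = v" using assms by (rule arefl_involution)
  also have "?c = aval (root_refl y x) v" by (rule aval_refl)
  also have "fst (acoroot x) - cartan (acoroot x) y *\<^sub>R fst y = fst (acoroot (root_refl y x))"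
    using assms by (simp add: acoroot_root_refl root_refl_def[of y "acoroot x"])
  finally show ?thesis unfolding arefl_def[of x ?u] arefl_def[of "root_refl y x"] aval_refl .
qed

lemma arefl_scaleR: assumes "c \<noteq> 0" shows "arefl (c *\<^sub>R x) = arefl x"
  using assms by (auto simp: fun_eq_iff arefl_def aval_scaleR acoroot_def field_simps)

lemma arefl_acoroot: "fst x \<noteq> 0 \<Longrightarrow> arefl (acoroot x) = arefl x"
  unfolding acoroot_def by (rule arefl_scaleR) simp

lemma acoroot_acoroot: "fst x \<noteq> 0 \<Longrightarrow> acoroot (acoroot x) = x"
  by (simp add: acoroot_def)

lemma arefl_eq_self_iff: "fst x \<noteq> 0 \<Longrightarrow> arefl x v = v \<longleftrightarrow> aval x v = 0"
  by (auto simp: arefl_def acoroot_def)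

fun word_map :: "('a::euclidean_space \<times> real) list \<Rightarrow> 'a \<Rightarrow> 'a" where
  "word_map [] = id" | "word_map (y # ys) = arefl y \<circ> word_map ys"

fun word_act :: "('a::euclidean_space \<times> real) list \<Rightarrow> 'a \<times> real \<Rightarrow> 'a \<times> real" where
  "word_act [] = id" | "word_act (y # ys) = root_refl y \<circ> word_act ys"

text \<open>
  Excludes the pairs that describe constant functions, for which \<open>arefl\<close> degenerates to the identity.
\<close>

definition anisotropic :: "('a::euclidean_space \<times> real) set \<Rightarrow> bool" where
  "anisotropic Y \<longleftrightarrow> (\<forall>y\<in>Y. fst y \<noteq> 0)"

lemma anisotropicD: "anisotropic Y \<Longrightarrow> y \<in> Y \<Longrightarrow> fst y \<noteq> 0"
  by (auto simp: anisotropic_def)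

lemma anisotropic_subset: "anisotropic Y \<Longrightarrow> Z \<subseteq> Y \<Longrightarrow> anisotropic Z"
  by (auto simp: anisotropic_def)

lemma word_map_append: "word_map (xs @ ys) = word_map xs \<circ> word_map ys"
  by (induction xs) (auto simp: o_assoc)

lemma word_act_append: "word_act (xs @ ys) = word_act xs \<circ> word_act ys"
  by (induction xs) (auto simp: o_assoc)

lemma word_map_rev: assumes "anisotropic (set ys)" shows "word_map (rev ys) (word_map ys v) = v"
  using assms by (induction ys) (auto simp: word_map_append anisotropic_def arefl_involution)

lemma word_map_rev': assumes "anisotropic (set ys)" shows "word_map ys (word_map (rev ys) v) = v"
  using word_map_rev[of "rev ys"] assms by simp

lemma word_act_rev: assumes "anisotropic (set ys)" shows "word_act (rev ys) (word_act ys v) = v"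
  using assms by (induction ys) (auto simp: word_act_append anisotropic_def root_refl_involution)

lemma word_act_rev': assumes "anisotropic (set ys)" shows "word_act ys (word_act (rev ys) v) = v"
  using word_act_rev[of "rev ys"] assms by simp

lemma linear_word_act: "linear (word_act ys)"
proof (induction ys)
  case Nil show ?case by (simp add: id_def linear_id[unfolded id_def])
next
  case (Cons y ys) then show ?case using linear_compose[OF Cons linear_root_refl] by (simp add: comp_def)
qed

lemma word_act_minus: "word_act ys (- x) = - word_act ys x"
  by (rule linear_neg[OF linear_word_act])

lemma aval_word_act:
  assumes "anisotropic (set ys)" shows "aval (word_act ys x) (word_map ys v) = aval x v"
  using assms
proof (induction ys arbitrary: x v)
  case (Cons y ys)
  then have "fst y \<noteq> 0" by (auto simp: anisotropic_def)
  with Cons show ?case by (simp add: aval_refl root_refl_involution anisotropic_def)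
qed simp

lemma word_act_inner:
  assumes "anisotropic (set ys)" shows "fst (word_act ys x) \<bullet> fst (word_act ys z) = fst x \<bullet> fst z"
  using assms by (induction ys) (auto simp: root_refl_inner anisotropic_def)

lemma arefl_word_act:
  assumes "anisotropic (set ys)"
  shows "arefl (word_act ys x) = word_map ys \<circ> arefl x \<circ> word_map (rev ys)"
  using assms
proof (induction ys)
  case (Cons y ys)
  then have y: "fst y \<noteq> 0" and ih: "arefl (word_act ys x) = word_map ys \<circ> arefl x \<circ> word_map (rev ys)"
    by (auto simp: anisotropic_def)
  show ?case
    by (rule ext) (simp add: word_map_append arefl_conj[OF y, symmetric] ih)
qed simp

lemma root_refl_word_act:
  assumes "anisotropic (set ys)"
  shows "root_refl (word_act ys x) (word_act ys z) = word_act ys (root_refl x z)"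
proof -
  have "cartan (word_act ys z) (word_act ys x) = cartan z x"
    by (simp add: cartan_def acoroot_def word_act_inner[OF assms])
  then show ?thesis by (simp add: root_refl_def linear_diff[OF linear_word_act] linear_cmul[OF linear_word_act])
qed

lemma word_act_conj:
  assumes "anisotropic (set us)"
  shows "word_act (map (word_act us) zs) (word_act us x) = word_act us (word_act zs x)"
  by (induction zs) (auto simp: root_refl_word_act[OF assms])

lemma word_map_conj:
  assumes "anisotropic (set us)"
  shows "word_map (map (word_act us) zs) = word_map us \<circ> word_map zs \<circ> word_map (rev us)"
  by (induction zs) (auto simp: fun_eq_iff word_map_rev[OF assms] word_map_rev'[OF assms] arefl_word_act[OF assms])

text \<open>
  The generated group, written with words only: a reflection is its own inverse.
\<close>

definition generated_maps :: "('a::euclidean_space \<times> real) set \<Rightarrow> ('a \<Rightarrow> 'a) set" where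
  "generated_maps Y = {word_map ys | ys. set ys \<subseteq> Y}"

text \<open>
  The roots whose reflections are the reflections of \<open>generated_maps Y\<close> as a group with simple
  reflections \<open>arefl ` Y\<close>. The set is closed under negation, because a root is sent to its
  negative by its own reflection.
\<close>

definition root_orbit :: "('a::euclidean_space \<times> real) set \<Rightarrow> ('a \<times> real) set" where
  "root_orbit Y = {word_act ys y | ys y. set ys \<subseteq> Y \<and> y \<in> Y}"

lemma root_orbitI: "set ys \<subseteq> Y \<Longrightarrow> y \<in> Y \<Longrightarrow> word_act ys y \<in> root_orbit Y"
  unfolding root_orbit_def by blast

lemma root_orbit_base: "Y \<subseteq> root_orbit Y"
  using root_orbitI[of "[]"] by auto

lemma root_orbit_root_refl: "x \<in> root_orbit Y \<Longrightarrow> y \<in> Y \<Longrightarrow> root_refl y x \<in> root_orbit Y"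
proof -
  assume "x \<in> root_orbit Y" "y \<in> Y"
  then obtain ys z where "set ys \<subseteq> Y" "z \<in> Y" "x = word_act ys z" by (auto simp: root_orbit_def)
  with \<open>y \<in> Y\<close> show ?thesis using root_orbitI[of "y # ys" Y z] by simp
qed

lemma root_orbit_root_refl_iff:
  assumes "anisotropic Y" "y \<in> Y" shows "root_refl y x \<in> root_orbit Y \<longleftrightarrow> x \<in> root_orbit Y"
  using root_orbit_root_refl[of "root_refl y x" Y y] root_orbit_root_refl[of x Y y] assms by (auto simp: root_refl_involution anisotropic_def)

lemma root_orbit_minus:
  assumes "anisotropic Y" "x \<in> root_orbit Y" shows "- x \<in> root_orbit Y"
proof -
  obtain ys y where x: "set ys \<subseteq> Y" "y \<in> Y" "x = word_act ys y" using assms(2) by (auto simp: root_orbit_def)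
  then have "word_act (ys @ [y]) y = - x"
    using assms(1) by (simp add: word_act_append root_refl_self anisotropic_def word_act_minus)
  then show ?thesis using root_orbitI[of "ys @ [y]" Y y] x by simp
qed

lemma root_orbit_minus_iff: "anisotropic Y \<Longrightarrow> - x \<in> root_orbit Y \<longleftrightarrow> x \<in> root_orbit Y"
  using root_orbit_minus[of Y x] root_orbit_minus[of Y "- x"] by auto

lemma generated_maps_word_map: "set ys \<subseteq> Y \<Longrightarrow> word_map ys \<in> generated_maps Y"
  by (auto simp: generated_maps_def)

lemma generated_maps_id: "id \<in> generated_maps Y" using generated_maps_word_map[of "[]"] by simp

lemma generated_maps_comp: "f \<in> generated_maps Y \<Longrightarrow> g \<in> generated_maps Y \<Longrightarrow> f \<circ> g \<in> generated_maps Y"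
  unfolding generated_maps_def by clarify (rule_tac x="ys @ ysa" in exI, auto simp: word_map_append)

lemma arefl_root_orbit_in_generated_maps:
  assumes "anisotropic Y" "x \<in> root_orbit Y" shows "arefl x \<in> generated_maps Y"
proof -
  obtain ys y where x: "set ys \<subseteq> Y" "y \<in> Y" "x = word_act ys y" using assms(2) by (auto simp: root_orbit_def)
  have "anisotropic (set ys)" using anisotropic_subset[OF assms(1) x(1)] .
  then have "arefl x = word_map (ys @ [y] @ rev ys)"
    by (simp add: x word_map_append arefl_word_act o_assoc)
  then show ?thesis using x generated_maps_word_map[of "ys @ [y] @ rev ys" Y] by simp
qed

lemma generated_maps_closed:
  assumes "\<And>z. z \<in> Z \<Longrightarrow> arefl z \<in> generated_maps Y" "f \<in> generated_maps Z" shows "f \<in> generated_maps Y"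
proof -
  have "word_map ys \<in> generated_maps Y" if "set ys \<subseteq> Z" for ys
    using that by (induction ys) (auto intro!: generated_maps_id generated_maps_comp assms(1))
  then show ?thesis using assms(2) by (auto simp: generated_maps_def)
qed

lemma generated_maps_mono: "Y \<subseteq> Z \<Longrightarrow> generated_maps Y \<subseteq> generated_maps Z"
  by (auto simp: generated_maps_def)

lemma generated_maps_root_orbit: assumes "anisotropic Y" shows "generated_maps (root_orbit Y) = generated_maps Y"
  using generated_maps_closed[of "root_orbit Y" Y] arefl_root_orbit_in_generated_maps[OF assms] generated_maps_mono[OF root_orbit_base] by blast

section \<open>Words acting on quadratic functions\<close>

definition zspan :: "'b::real_vector set \<Rightarrow> 'b set" where
  "zspan B = {\<Sum>y\<in>B. of_int (n y) *\<^sub>R y | n :: 'b \<Rightarrow> int. True}"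

lemma zspan_zero: "0 \<in> zspan B"
  unfolding zspan_def by (rule CollectI, rule exI[of _ "\<lambda>_. 0"]) simp

lemma zspan_add: "x \<in> zspan B \<Longrightarrow> y \<in> zspan B \<Longrightarrow> x + y \<in> zspan B"
  unfolding zspan_def
  by clarify (rule_tac x="\<lambda>z. n z + na z" in exI, simp add: sum.distrib scaleR_add_left)

lemma zspan_int: "x \<in> zspan B \<Longrightarrow> of_int k *\<^sub>R x \<in> zspan B"
  unfolding zspan_def
  by clarify (rule_tac x="\<lambda>z. k * n z" in exI, simp add: scaleR_sum_right)

lemma zspan_scaleR_Ints: "x \<in> zspan B \<Longrightarrow> c \<in> \<int> \<Longrightarrow> c *\<^sub>R x \<in> zspan B"
  by (auto elim!: Ints_cases intro: zspan_int)

lemma zspan_diff: "x \<in> zspan B \<Longrightarrow> y \<in> zspan B \<Longrightarrow> x - y \<in> zspan B"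
  using zspan_add[of x B "- y"] zspan_int[of y B "- 1"] by simp

lemma zspan_base: assumes "finite B" "y \<in> B" shows "y \<in> zspan B"
proof -
  have "y = (\<Sum>z\<in>B. of_int (if z = y then 1 else 0) *\<^sub>R z)"
  proof -
    have "(\<Sum>z\<in>B. of_int (if z = y then 1 else 0) *\<^sub>R z) = (\<Sum>z\<in>B. if z = y then z else 0)"
      by (rule sum.cong) auto
    with assms show ?thesis by simp
  qed
  then show ?thesis unfolding zspan_def by (intro CollectI exI[of _ "\<lambda>z. if z = y then 1 else 0"]) simp
qed

lemma zspan_sum:
  assumes "\<And>i. i \<in> A \<Longrightarrow> f i \<in> zspan B" shows "sum f A \<in> zspan B"
  using assms by (induction A rule: infinite_finite_induct) (auto simp: zspan_zero zspan_add)

lemma zspan_closed: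
  assumes "x \<in> zspan A" "A \<subseteq> zspan B" shows "x \<in> zspan B"
  using assms by (auto simp: zspan_def[of A] intro!: zspan_sum zspan_int)

lemma zspan_subset_span: "zspan B \<subseteq> span B"
  unfolding zspan_def by clarify (intro span_sum span_scale span_base)

lemma zspan_inner_Ints:
  fixes h :: "'b::real_inner"
  assumes "x \<in> zspan B" "\<And>y. y \<in> B \<Longrightarrow> h \<bullet> y \<in> \<int>" shows "h \<bullet> x \<in> \<int>"
  using assms by (auto simp: zspan_def inner_sum_right intro!: Ints_sum Ints_mult)

lemma zspan_cartan_Ints:
  assumes "x \<in> zspan B" "\<And>y. y \<in> B \<Longrightarrow> cartan y z \<in> \<int>" shows "cartan x z \<in> \<int>"
  using assms by (auto simp: zspan_def cartan_def fst_sum inner_sum_left intro!: Ints_sum Ints_mult)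

text \<open>
  The additive constant is omitted: the differences \<open>quadratic h \<circ> f - quadratic h\<close> do not see it.
\<close>

definition quadratic :: "'a::euclidean_space \<times> real \<Rightarrow> 'a \<Rightarrow> real" where
  "quadratic h v = snd h / 2 * (v \<bullet> v) + fst h \<bullet> v"

text \<open>
  A reflection is an isometry, so the squared norm changes by an affine function only. The change
  vanishes on the hyperplane of \<open>y\<close>, so it is a multiple of \<open>aval y\<close>.
\<close>

lemma quadratic_refl:
  assumes "fst y \<noteq> 0"
  shows "quadratic h (arefl y v) = quadratic h v - (h \<bullet> acoroot y) * aval y v"
proof -
  define b where "b = fst y \<bullet> fst y"
  define t where "t = aval y v * (2 / b)"
  have tb: "t * b = 2 * aval y v" using assms by (simp add: t_def b_def)
  have r: "arefl y v = v - t *\<^sub>R fst y"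
    by (simp add: arefl_def acoroot_def b_def t_def)
  have "(v - t *\<^sub>R u) \<bullet> (v - t *\<^sub>R u) = v \<bullet> v - 2 * t * (v \<bullet> u) + t * (t * (u \<bullet> u))" for u
    by (simp add: inner_diff_left inner_diff_right inner_commute)
  from this[of "fst y"] have "arefl y v \<bullet> arefl y v = v \<bullet> v - 2 * t * (v \<bullet> fst y) + t * (t * b)"
    unfolding r b_def .
  then have q: "arefl y v \<bullet> arefl y v = v \<bullet> v - 2 * (t * snd y)"
    unfolding tb by (simp add: aval_def algebra_simps)
  have i: "(h \<bullet> acoroot y) * aval y v = t * (fst h \<bullet> fst y + snd h * snd y)"
    by (simp add: acoroot_def b_def t_def inner_prod_def add_divide_distrib[symmetric])
  have "fst h \<bullet> arefl y v = fst h \<bullet> v - t * (fst h \<bullet> fst y)"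
    unfolding r by (simp add: inner_diff_right)
  then show ?thesis
    unfolding quadratic_def q i by (simp add: algebra_simps)
qed

text \<open>
  The combination of roots by which a word changes \<open>quadratic h\<close>. The fold runs from the left because
  composing with one more reflection on the right reflects the difference accumulated so far.
\<close>

definition defect :: "'a::euclidean_space \<times> real \<Rightarrow> ('a \<times> real) list \<Rightarrow> 'a \<times> real" where
  "defect h ys = foldl (\<lambda>z y. z + (h \<bullet> acoroot y - cartan z y) *\<^sub>R y) 0 ys"

lemma defect_Nil: "defect h [] = 0" by (simp add: defect_def)

lemma defect_snoc:
  "defect h (ys @ [y]) = defect h ys + (h \<bullet> acoroot y - cartan (defect h ys) y) *\<^sub>R y"
  by (simp add: defect_def)

lemma quadratic_word_map:
  assumes "anisotropic (set ys)"
  shows "quadratic h (word_map ys v) = quadratic h v - aval (defect h ys) v"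
  using assms
proof (induction ys arbitrary: v rule: rev_induct)
  case Nil show ?case by (simp add: defect_Nil aval_zero)
next
  case (snoc y ys)
  then have y: "fst y \<noteq> 0" and "anisotropic (set ys)" by (auto simp: anisotropic_def)
  then have "quadratic h (word_map (ys @ [y]) v) = quadratic h (arefl y v) - aval (defect h ys) (arefl y v)"
    using snoc.IH by (simp add: word_map_append)
  also have "\<dots> = quadratic h v - (h \<bullet> acoroot y) * aval y v - aval (root_refl y (defect h ys)) v"
    using y by (simp add: quadratic_refl aval_refl)
  also have "\<dots> = quadratic h v - aval (defect h (ys @ [y])) v"
    by (simp add: defect_snoc root_refl_def aval_add aval_diff aval_scaleR algebra_simps)
  finally show ?case .
qed

text \<open>
  The defect can be read off the map, so it is an invariant of the element and not of the word.
\<close>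

lemma defect_cong:
  assumes "anisotropic (set ys)" "anisotropic (set zs)" "word_map ys = word_map zs"
  shows "defect h ys = defect h zs"
proof (rule aval_inject, rule ext)
  fix v
  show "aval (defect h ys) v = aval (defect h zs) v"
    using quadratic_word_map[OF assms(1), of h v] quadratic_word_map[OF assms(2), of h v] assms(3) by simp
qed

lemma defect_in_span: "defect h ys \<in> span (set ys)"
proof (induction ys rule: rev_induct)
  case (snoc y ys)
  then have "defect h ys \<in> span (set (ys @ [y]))" using span_mono[of "set ys" "set (ys @ [y])"] by auto
  then show ?case unfolding defect_snoc by (intro span_add span_scale) (auto intro: span_base)
qed (simp add: defect_Nil)

lemma defect_orthogonal:
  assumes "\<And>y. y \<in> set ys \<Longrightarrow> h \<bullet> y = 0" shows "defect h ys = 0"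
  using assms
  by (induction ys rule: rev_induct) (auto simp: defect_Nil defect_snoc acoroot_def cartan_linear)

text \<open>
  With independent roots the coefficients that the fold collects all vanish. The last one then says
  that \<open>h\<close> is orthogonal to the last root, and the others follow inductively.
\<close>

lemma defect_eq_0D:
  assumes "anisotropic (set ys)" "distinct ys" "independent (set ys)" "defect h ys = 0" "y \<in> set ys"
  shows "h \<bullet> y = 0"
  using assms
proof (induction ys arbitrary: y rule: rev_induct)
  case (snoc z ys)
  let ?c = "h \<bullet> acoroot z - cartan (defect h ys) z"
  have ind: "independent (set ys)" using snoc.prems(3) by (rule independent_mono) auto
  have nz: "z \<notin> span (set ys)"
    using snoc.prems(2,3) by (auto simp: independent_insert)
  have e: "defect h ys + ?c *\<^sub>R z = 0" using snoc.prems(4) by (simp add: defect_snoc)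
  have c: "?c = 0"
  proof (rule ccontr)
    assume c: "?c \<noteq> 0"
    have "?c *\<^sub>R z = - defect h ys" using e by (simp add: add_eq_0_iff)
    then have "(1 / ?c) *\<^sub>R (?c *\<^sub>R z) = (1 / ?c) *\<^sub>R (- defect h ys)" by (rule arg_cong)
    then have "z = (1 / ?c) *\<^sub>R (- defect h ys)" using c by simp
    moreover have "- defect h ys \<in> span (set ys)" using defect_in_span by (rule span_neg)
    ultimately have "z \<in> span (set ys)" using span_scale by metis
    with nz show False by simp
  qed
  then have d: "defect h ys = 0" using e by simp
  have "h \<bullet> z = 0" using c d snoc.prems(1) by (auto simp: acoroot_def cartan_linear anisotropic_def)
  moreover have "h \<bullet> y = 0" if "y \<in> set ys"
    using snoc.IH[OF _ _ ind d that] snoc.prems by (auto simp: anisotropic_def)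
  ultimately show ?case using snoc.prems(5) by auto
qed simp

lemma exists_inner_prescribed:
  fixes B :: "'b::euclidean_space set"
  assumes "independent B"
  obtains h where "\<And>y. y \<in> B \<Longrightarrow> h \<bullet> y = f y"
proof -
  obtain g :: "'b \<Rightarrow> real" where g: "linear g" "\<forall>y\<in>B. g y = f y"
    using linear_independent_extend[OF assms] by blast
  have "adjoint g 1 \<bullet> y = g y" for y
    using adjoint_works[OF g(1), of y 1] by (simp add: inner_commute)
  then show thesis using that g(2) by metis
qed

lemma zspan_defect:
  assumes "anisotropic (set zs)"
    and "\<And>x y. x \<in> set zs \<Longrightarrow> y \<in> set zs \<Longrightarrow> cartan x y \<in> \<int>"
    and "\<And>y. y \<in> set zs \<Longrightarrow> h \<bullet> acoroot y \<in> \<int>"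
  shows "defect h zs \<in> zspan (set zs)"
  using assms
proof (induction zs rule: rev_induct)
  case (snoc z zs)
  have d: "defect h zs \<in> zspan (set zs)"
    using snoc.IH snoc.prems by (auto simp: anisotropic_def)
  have "cartan (defect h zs) z \<in> \<int>"
    by (rule zspan_cartan_Ints[OF d]) (use snoc.prems in auto)
  moreover have "defect h zs \<in> zspan (set (zs @ [z]))"
    by (rule zspan_closed[OF d]) (auto intro!: zspan_base)
  ultimately show ?case
    unfolding defect_snoc using snoc.prems(3)[of z]
    by (intro zspan_add zspan_scaleR_Ints Ints_diff) (auto intro: zspan_base)
qed (simp add: defect_Nil zspan_zero)

text \<open>
  The system that determines the coefficients of the defect from the numbers \<open>h \<bullet> acoroot y\<close> is
  unitriangular with integral entries, hence solvable over the integers.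
\<close>

lemma defect_prescribed:
  fixes ys :: "('a::euclidean_space \<times> real) list" and n :: "'a \<times> real \<Rightarrow> int"
  assumes "anisotropic (set ys)" "distinct ys" "independent (set ys)"
    and "\<And>x y. x \<in> set ys \<Longrightarrow> y \<in> set ys \<Longrightarrow> cartan x y \<in> \<int>"
  shows "\<exists>m. \<forall>h. (\<forall>y\<in>set ys. h \<bullet> acoroot y = of_int (m y)) \<longrightarrow>
           defect h ys = (\<Sum>y\<in>set ys. of_int (n y) *\<^sub>R y)"
  using assms
proof (induction ys rule: rev_induct)
  case (snoc z ys)
  have ind: "independent (set ys)" using snoc.prems(3) by (rule independent_mono) auto
  obtain m :: "'a \<times> real \<Rightarrow> int" where m: "\<And>h. (\<forall>y\<in>set ys. h \<bullet> acoroot y = of_int (m y)) \<Longrightarrow>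
           defect h ys = (\<Sum>y\<in>set ys. of_int (n y) *\<^sub>R y)"
    using snoc.IH[OF _ _ ind] snoc.prems by (auto simp: anisotropic_def)
  let ?s = "\<Sum>y\<in>set ys. of_int (n y) *\<^sub>R y"
  have "?s \<in> zspan (set ys)" by (auto simp: zspan_def)
  then have "cartan ?s z \<in> \<int>" by (rule zspan_cartan_Ints) (use snoc.prems in auto)
  then obtain k where k: "cartan ?s z = of_int k" by (auto elim: Ints_cases)
  have zn: "z \<notin> set ys" using snoc.prems(2) by simp
  show ?case
  proof (intro exI[of _ "m(z := n z + k)"] allI impI)
    fix h assume h: "\<forall>y\<in>set (ys @ [z]). h \<bullet> acoroot y = of_int ((m(z := n z + k)) y)"
    have "defect h ys = ?s" by (rule m) (use h zn in auto)
    moreover have "h \<bullet> acoroot z = of_int (n z + k)" using h by simp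
    ultimately show "defect h (ys @ [z]) = (\<Sum>y\<in>set (ys @ [z]). of_int (n y) *\<^sub>R y)"
      using zn by (simp add: defect_snoc k add.commute)
  qed
qed (simp add: defect_Nil)

lemma inj_on_acoroot: "anisotropic B \<Longrightarrow> inj_on acoroot B"
  by (rule inj_on_inverseI[of _ acoroot]) (auto simp: acoroot_acoroot anisotropic_def)

text \<open>
  Scaling the members of a basis by nonzero factors keeps the span and the cardinality.
\<close>

lemma independent_acoroot:
  assumes "anisotropic B" "independent B" shows "independent (acoroot ` B)"
proof (rule card_le_dim_spanning[of _ "span B"])
  have fin: "finite B" using assms(2) by (rule independent_imp_finite)
  show "acoroot ` B \<subseteq> span B" by (auto simp add: acoroot_def simp del: scaleR_Pair intro!: span_scale[OF span_base])
  have "b \<in> span (acoroot ` B)" if "b \<in> B" for b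
  proof -
    have "b = ((fst b \<bullet> fst b) / 2) *\<^sub>R acoroot b" using anisotropicD[OF assms(1) that] by (simp add: acoroot_def)
    also have "\<dots> \<in> span (acoroot ` B)" using that by (intro span_scale span_base) auto
    finally show ?thesis .
  qed
  then show "span B \<subseteq> span (acoroot ` B)" by (intro span_minimal) auto
  show "finite (acoroot ` B)" using fin by simp
  show "card (acoroot ` B) \<le> dim (span B)"
    using fin by (simp add: card_image_le dim_span dim_eq_card_independent assms(2))
qed

text \<open>
  An integral combination of \<open>ys\<close> is the defect of \<open>ys\<close> for some \<open>h\<close> that is integral on the coroots
  of \<open>ys\<close>, hence on the coroots of \<open>zs\<close>. The defect of \<open>zs\<close> for the same \<open>h\<close> is the same
  vector, and it is an integral combination of \<open>zs\<close>.
\<close>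

lemma zspan_transfer:
  fixes ys zs :: "('a::euclidean_space \<times> real) list"
  assumes "anisotropic (set ys)" "anisotropic (set zs)" "word_map ys = word_map zs"
    and "distinct ys" "independent (set ys)"
    and "\<And>x y. x \<in> set ys \<Longrightarrow> y \<in> set ys \<Longrightarrow> cartan x y \<in> \<int>"
    and "\<And>x y. x \<in> set zs \<Longrightarrow> y \<in> set zs \<Longrightarrow> cartan x y \<in> \<int>"
    and "acoroot ` set zs \<subseteq> zspan (acoroot ` set ys)"
  shows "zspan (set ys) \<subseteq> zspan (set zs)"
proof
  fix x assume "x \<in> zspan (set ys)"
  then obtain n :: "'a \<times> real \<Rightarrow> int" where x: "x = (\<Sum>y\<in>set ys. of_int (n y) *\<^sub>R y)"
    by (auto simp: zspan_def)
  have "\<exists>m::'a \<times> real \<Rightarrow> int. \<forall>h. (\<forall>y\<in>set ys. h \<bullet> acoroot y = of_int (m y)) \<longrightarrow> defect h ys = x"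
    unfolding x using assms(1,4,5,6) by (rule defect_prescribed)
  then obtain m :: "'a \<times> real \<Rightarrow> int"
    where m: "\<forall>h. (\<forall>y\<in>set ys. h \<bullet> acoroot y = of_int (m y)) \<longrightarrow> defect h ys = x" ..
  define f where "f y = (fst y \<bullet> fst y) / 2 * real_of_int (m y)" for y
  \<comment> \<open>A vector with \<open>h \<bullet> acoroot y = m y\<close> exists because the roots \<open>ys\<close> are independent.\<close>
  obtain h where h: "\<And>y. y \<in> set ys \<Longrightarrow> h \<bullet> y = f y"
    using exists_inner_prescribed[OF assms(5), of f] by metis
  have Xc: "h \<bullet> acoroot y = of_int (m y)" if "y \<in> set ys" for y
    using h[OF that] anisotropicD[OF assms(1) that] by (simp add: acoroot_def f_def field_simps)
  with m have "x = defect h ys" by metis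
  also have "\<dots> = defect h zs" by (rule defect_cong[OF assms(1-3)])
  also have "\<dots> \<in> zspan (set zs)"
  proof (rule zspan_defect[OF assms(2,7)])
    fix y assume "y \<in> set zs"
    then have "acoroot y \<in> zspan (acoroot ` set ys)" using assms(8) by blast
    then show "h \<bullet> acoroot y \<in> \<int>" by (rule zspan_inner_Ints) (auto simp: Xc)
  qed
  finally show "x \<in> zspan (set zs)" .
qed

text \<open>
  A vector \<open>h\<close> orthogonal to all roots of \<open>zs\<close> has defect zero for \<open>zs\<close>, hence for \<open>ys\<close>, hence is
  orthogonal to all roots of \<open>ys\<close>.
\<close>

lemma independent_word_spans:
  fixes ys zs :: "('a::euclidean_space \<times> real) list"
  assumes "anisotropic (set ys)" "anisotropic (set zs)" "word_map ys = word_map zs"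
    and "distinct ys" "independent (set ys)" "span (set ys) = UNIV"
  shows "span (set zs) = UNIV"
proof (rule ccontr)
  assume "span (set zs) \<noteq> UNIV"
  then have "dim (set zs) < DIM('a \<times> real)"
    by (metis dim_eq_full dim_subset_UNIV le_neq_implies_less)
  then obtain h where h: "h \<noteq> 0" "\<And>z. z \<in> span (set zs) \<Longrightarrow> orthogonal h z"
    using orthogonal_to_subspace_exists by blast
  then have "defect h zs = 0" by (intro defect_orthogonal) (auto simp: orthogonal_def span_base)
  then have "defect h ys = 0" using defect_cong[OF assms(1-3)] by simp
  then have "h \<bullet> y = 0" if "y \<in> set ys" for y
    using defect_eq_0D[OF assms(1,4,5)] that by blast
  then have "orthogonal h y" if "y \<in> span (set ys)" for y
    using orthogonal_to_span[OF that] by (simp add: orthogonal_def)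
  then have "orthogonal h h" using assms(6) by auto
  with h(1) show False by (simp add: orthogonal_def)
qed

lemma word_map_diff: "word_map ys u - word_map ys v = fst (word_act ys (u - v, s))"
proof (induction ys)
  case (Cons y ys)
  have "arefl y a - arefl y b = fst (root_refl y (a - b, t))" for a b t
  proof -
    have "arefl y a - arefl y b = (a - b) - (aval y a - aval y b) *\<^sub>R fst (acoroot y)"
      by (simp add: arefl_def scaleR_diff_left)
    also have "aval y a - aval y b = (a - b) \<bullet> fst y" by (simp add: aval_def inner_diff_left)
    finally show ?thesis by (simp add: root_refl_def cartan_def acoroot_def)
  qed
  from this[of "word_map ys u" "word_map ys v" "snd (word_act ys (u - v, s))"] show ?case
    by (simp add: Cons)
qed simp

lemma word_map_inner:
  assumes "anisotropic (set ys)"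
  shows "(word_map ys u - word_map ys v) \<bullet> (word_map ys u' - word_map ys v') = (u - v) \<bullet> (u' - v')"
  by (simp add: word_map_diff[of _ _ _ 0] word_act_inner[OF assms])

text \<open>
  The squared distance to the fixed point \<open>p\<close> is an invariant quadratic function, so its defect is zero.
\<close>

lemma fixed_point_of_independent_word:
  assumes "anisotropic (set ys)" "distinct ys" "independent (set ys)" "word_map ys p = p" "y \<in> set ys"
  shows "aval y p = 0"
proof -
  \<comment> \<open>Up to a constant, \<open>quadratic ?h\<close> is half the squared distance to \<open>p\<close>.\<close>
  let ?h = "(- p, 1::real)"
  have sq: "quadratic ?h v = (v - p) \<bullet> (v - p) / 2 - p \<bullet> p / 2" for v
    by (simp add: quadratic_def inner_diff_left inner_diff_right inner_commute field_simps)
  have "quadratic ?h (word_map ys v) = quadratic ?h v" for v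
    using word_map_inner[OF assms(1), of v p v p] assms(4) by (simp add: sq)
  then have "defect ?h ys = 0"
    using quadratic_word_map[OF assms(1), of ?h] by (intro aval_inject) (auto simp: aval_zero)
  then have "?h \<bullet> y = 0" using defect_eq_0D assms(1,2,3,5) by blast
  then show ?thesis by (simp add: inner_prod_def aval_def)
qed

section \<open>Descents in affine root sets\<close>

text \<open>
  The properties of the affine roots that the descents below use. Local finiteness says that only
  finitely many hyperplanes come within a given distance of a point: \<open>\<bar>aval x v\<bar> / norm (fst x)\<close> is the
  distance of \<open>v\<close> from the hyperplane of \<open>x\<close>.
\<close>

locale affine_root_set =
  fixes R :: "('a::euclidean_space \<times> real) set"
  assumes anisotropic_R: "anisotropic R"
    and root_refl_R: "x \<in> R \<Longrightarrow> y \<in> R \<Longrightarrow> root_refl y x \<in> R"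
    and cartan_R: "x \<in> R \<Longrightarrow> y \<in> R \<Longrightarrow> cartan x y \<in> \<int>"
    and reduced_R: "x \<in> R \<Longrightarrow> y \<in> R \<Longrightarrow> fst x = c *\<^sub>R fst y \<Longrightarrow> c = 1 \<or> c = - 1"
    and locally_finite_R: "finite {x \<in> R. \<bar>aval x v\<bar> \<le> c * norm (fst x)}"
begin

lemma fst_R: "x \<in> R \<Longrightarrow> fst x \<noteq> 0"
  using anisotropic_R by (rule anisotropicD)

lemma anisotropic_sub: "Y \<subseteq> R \<Longrightarrow> anisotropic Y"
  using anisotropic_R by (rule anisotropic_subset)

lemma word_act_R: "set ys \<subseteq> R \<Longrightarrow> x \<in> R \<Longrightarrow> word_act ys x \<in> R"
  by (induction ys) (auto simp: root_refl_R)

lemma root_orbit_R: "Y \<subseteq> R \<Longrightarrow> root_orbit Y \<subseteq> R"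
  unfolding root_orbit_def using word_act_R by blast

lemma minus_R: "x \<in> R \<Longrightarrow> - x \<in> R"
  using root_refl_R[of x x] by (simp add: root_refl_self fst_R)

lemma parallel_R:
  assumes "x \<in> R" "y \<in> R" "(fst x \<bullet> fst y)\<^sup>2 = (fst x \<bullet> fst x) * (fst y \<bullet> fst y)"
  shows "fst x = fst y \<or> fst x = - fst y"
proof -
  have "(fst x \<bullet> fst y)\<^sup>2 = (norm (fst x) * norm (fst y))\<^sup>2"
    using assms(3) by (simp add: power_mult_distrib power2_norm_eq_inner)
  then have "\<bar>fst x \<bullet> fst y\<bar> = norm (fst x) * norm (fst y)"
    using power2_eq_iff_nonneg[of "\<bar>fst x \<bullet> fst y\<bar>" "norm (fst x) * norm (fst y)"] by simp
  then have "collinear {0, fst x, fst y}" using norm_cauchy_schwarz_equal by blast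
  then obtain c where "fst y = c *\<^sub>R fst x"
    using fst_R[OF assms(1)] fst_R[OF assms(2)] by (auto simp: collinear_lemma)
  then show ?thesis using reduced_R[OF assms(2,1), of c] by auto
qed

text \<open>
  The product of the two Cartan integers is at most 4, and equal to 4 only for parallel roots.
\<close>

lemma cartan_product:
  assumes "x \<in> R" "y \<in> R" "fst x \<bullet> fst y \<noteq> 0"
  shows "fst x = fst y \<or> fst x = - fst y \<or> \<bar>cartan x y\<bar> = 1 \<or> \<bar>cartan y x\<bar> = 1"
proof -
  let ?a = "fst x \<bullet> fst x" and ?b = "fst y \<bullet> fst y" and ?g = "fst x \<bullet> fst y"
  have pos: "?a > 0" "?b > 0" using fst_R assms(1,2) by auto
  obtain k l where kl: "cartan x y = of_int k" "cartan y x = of_int l"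
    using cartan_R assms(1,2) by (meson Ints_cases)
  have k: "of_int k = 2 * ?g / ?b" and l: "of_int l = 2 * ?g / ?a"
    using kl by (simp_all add: cartan_def acoroot_def inner_commute)
  have kl4: "of_int (k * l) * (?a * ?b) = 4 * ?g\<^sup>2"
    using pos by (simp add: k l power2_eq_square)
  have cs: "?g\<^sup>2 \<le> ?a * ?b" by (rule Cauchy_Schwarz_ineq)
  show ?thesis
  proof (cases "?g\<^sup>2 = ?a * ?b")
    case True
    then show ?thesis using parallel_R[OF assms(1,2)] by blast
  next
    case False
    with cs kl4 have "of_int (k * l) * (?a * ?b) < 4 * (?a * ?b)" by linarith
    then have "real_of_int (k * l) < 4" using pos by (simp add: mult_less_cancel_right)
    moreover have "real_of_int (k * l) > 0"
      using kl4 pos assms(3) by (metis mult_pos_pos zero_less_mult_pos2 zero_less_numeral zero_less_power2)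
    ultimately have "k * l < 4" "0 < k * l" by linarith+
    then have "\<bar>k\<bar> * \<bar>l\<bar> < 4" "0 < \<bar>k\<bar> * \<bar>l\<bar>" by (simp_all add: abs_mult[symmetric])
    moreover have "\<bar>k\<bar> * \<bar>l\<bar> \<ge> 2 * 2" if "\<bar>k\<bar> \<ge> 2" "\<bar>l\<bar> \<ge> 2" using that by (intro mult_mono) auto
    ultimately have "\<bar>k\<bar> = 1 \<or> \<bar>l\<bar> = 1"
      by (smt (verit) mult_eq_0_iff zero_less_mult_iff)
    then show ?thesis using kl by auto
  qed
qed

text \<open>
  Since \<open>fst x \<bullet> fst x > 0\<close>, some term \<open>n y * (fst x \<bullet> fst y)\<close> is positive. Reflecting \<open>x\<close> in this \<open>y\<close>
  lowers \<open>n y\<close> by \<open>cartan x y\<close>, which has the same sign. Unless the roots are parallel, \<open>cartan x y\<close>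
  or \<open>cartan y x\<close> is \<open>\<plusminus>1\<close>. In the first case the nonzero integer \<open>n y\<close> moves one step towards 0. In the
  second case the coefficient of the coroot of \<open>y\<close> in the coroot of \<open>x\<close> does so; it is a positive multiple
  of \<open>n y\<close> and an integer by assumption, so \<open>\<bar>n y\<bar>\<close> drops again. The common zero \<open>p\<close> excludes
  distinct parallel roots, so the descent can only end at \<open>\<plusminus>y\<close>.
\<close>

lemma in_orbit_if_integral:
  assumes B: "B \<subseteq> R" "finite B" "\<And>y. y \<in> B \<Longrightarrow> aval y p = 0"
    and "x \<in> R" "x = (\<Sum>y\<in>B. of_int (n y) *\<^sub>R y)"
    and "\<And>y. y \<in> B \<Longrightarrow> of_int (n y) * (fst y \<bullet> fst y) / (fst x \<bullet> fst x) \<in> \<int>"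
  shows "x \<in> root_orbit B"
  using assms(4-)
proof (induction "nat (\<Sum>y\<in>B. \<bar>n y\<bar>)" arbitrary: n x rule: less_induct)
  case less
  let ?a = "fst x \<bullet> fst x"
  have a: "?a > 0" using fst_R less.prems(1) by auto
  have "?a = fst x \<bullet> fst (\<Sum>y\<in>B. of_int (n y) *\<^sub>R y)" using less.prems(2) by simp
  also have "\<dots> = (\<Sum>y\<in>B. of_int (n y) * (fst x \<bullet> fst y))" by (simp add: fst_sum inner_sum_right)
  finally have "(\<Sum>y\<in>B. of_int (n y) * (fst x \<bullet> fst y)) > 0" using a by simp
  then have "\<not> (\<forall>y\<in>B. of_int (n y) * (fst x \<bullet> fst y) \<le> 0)"
    by (meson linorder_not_less sum_nonpos)
  then obtain y where y: "y \<in> B" and ny: "of_int (n y) * (fst x \<bullet> fst y) > 0"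
    by (auto simp: not_le)
  let ?b = "fst y \<bullet> fst y"
  have yR: "y \<in> R" using y B(1) by auto
  then have b: "?b > 0" using fst_R by auto
  obtain k where k: "cartan x y = of_int k" using cartan_R less.prems(1) yR by (meson Ints_cases)
  obtain l where l: "cartan y x = of_int l" using cartan_R less.prems(1) yR by (meson Ints_cases)
  obtain m where m: "of_int (n y) * ?b / ?a = real_of_int m" using less.prems(3)[OF y] by (auto elim: Ints_cases)
  have kg: "of_int k = 2 * (fst x \<bullet> fst y) / ?b" and lg: "of_int l = 2 * (fst x \<bullet> fst y) / ?a"
    using k l by (simp_all add: cartan_def acoroot_def inner_commute)
  have "of_int (n y) * real_of_int k > 0" using ny b by (simp add: kg zero_less_divide_iff algebra_simps)
  then have nk: "n y * k > 0" by (metis of_int_0_less_iff of_int_mult)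
  have valx: "aval x p = 0" using B(3) by (subst less.prems(2)) (simp add: aval_sum aval_scaleR)
  consider (par) "fst x = fst y \<or> fst x = - fst y" | (one) "\<bar>k\<bar> = 1 \<or> \<bar>l\<bar> = 1"
    using cartan_product[OF less.prems(1) yR] ny k l by fastforce
  then show ?case
  proof cases
    case par
    then have "x = y \<or> x = - y"
      using valx B(3)[OF y] by (auto simp: aval_def prod_eq_iff)
    moreover have "y \<in> root_orbit B" using y root_orbit_base by blast
    moreover from this have "- y \<in> root_orbit B" by (rule root_orbit_minus[OF anisotropic_sub[OF B(1)]])
    ultimately show ?thesis by metis
  next
    case one
    have dec: "\<bar>n y - k\<bar> < \<bar>n y\<bar>"
      using one
    proof
      assume "\<bar>k\<bar> = 1" then show ?thesis using nk by (auto simp: abs_if zero_less_mult_iff split: if_splits)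
    next
      assume l1: "\<bar>l\<bar> = 1"
      have ml: "real_of_int (m - l) = of_int (n y - k) * (?b / ?a)"
        using m a b by (simp add: kg lg field_simps)
      have "of_int m * real_of_int l = (of_int (n y) * of_int k) * (?b / ?a)\<^sup>2"
        using a b by (simp add: m[symmetric] kg lg field_simps power2_eq_square)
      moreover have "(of_int (n y) * real_of_int k) * (?b / ?a)\<^sup>2 > 0"
        using nk a b by (metis divide_pos_pos mult_pos_pos of_int_0_less_iff of_int_mult zero_less_power)
      ultimately have "m * l > 0" by (metis of_int_0_less_iff of_int_mult)
      then have "\<bar>m - l\<bar> < \<bar>m\<bar>" using l1 by (auto simp: abs_if zero_less_mult_iff split: if_splits)
      then have "\<bar>real_of_int (m - l)\<bar> < \<bar>real_of_int m\<bar>" by linarith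
      moreover have "\<bar>real_of_int (m - l)\<bar> = \<bar>of_int (n y - k)\<bar> * (?b / ?a)"
        unfolding ml abs_mult using a b by simp
      moreover have "\<bar>real_of_int m\<bar> = \<bar>of_int (n y)\<bar> * (?b / ?a)"
        unfolding m[symmetric] using a b by (simp add: abs_mult)
      ultimately have "\<bar>real_of_int (n y - k)\<bar> * (?b / ?a) < \<bar>of_int (n y)\<bar> * (?b / ?a)" by simp
      then have "\<bar>real_of_int (n y - k)\<bar> < \<bar>of_int (n y)\<bar>"
        by (rule mult_right_less_imp_less) (use a b in simp)
      then show ?thesis by linarith
    qed
    define n' where "n' = n(y := n y - k)"
    have sum': "(\<Sum>z\<in>B. \<bar>n' z\<bar>) < (\<Sum>z\<in>B. \<bar>n z\<bar>)"
      using dec y B(2) by (intro sum_strict_mono_ex1) (auto simp: n'_def)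
    have xs: "root_refl y x = (\<Sum>z\<in>B. of_int (n' z) *\<^sub>R z)"
    proof -
      have "(\<Sum>z\<in>B. of_int (n' z) *\<^sub>R z) = (\<Sum>z\<in>B. of_int (n z) *\<^sub>R z - (if z = y then of_int k *\<^sub>R y else 0))"
        by (rule sum.cong) (auto simp: n'_def scaleR_diff_left)
      also have "\<dots> = x - of_int k *\<^sub>R y"
        using y B(2) less.prems(2) by (simp add: sum_subtractf)
      finally show ?thesis by (simp add: root_refl_def k)
    qed
    have norm': "fst (root_refl y x) \<bullet> fst (root_refl y x) = ?a" using root_refl_inner[of y x x] fst_R[OF yR] by simp
    have "root_refl y x \<in> root_orbit B"
    proof (rule less.hyps[of n'])
      have "0 \<le> (\<Sum>z\<in>B. \<bar>n' z\<bar>)" by (intro sum_nonneg) auto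
      then show "nat (\<Sum>z\<in>B. \<bar>n' z\<bar>) < nat (\<Sum>z\<in>B. \<bar>n z\<bar>)" using sum' by linarith
      show "root_refl y x \<in> R" using root_refl_R less.prems(1) yR by blast
      show "root_refl y x = (\<Sum>z\<in>B. of_int (n' z) *\<^sub>R z)" by (rule xs)
      fix z assume z: "z \<in> B"
      have "of_int k * ?b / ?a = real_of_int l" using a b by (simp add: kg lg)
      then have "of_int (n y - k) * ?b / ?a = real_of_int (m - l)"
        using m by (simp add: left_diff_distrib diff_divide_distrib)
      then show "of_int (n' z) * (fst z \<bullet> fst z) / (fst (root_refl y x) \<bullet> fst (root_refl y x)) \<in> \<int>"
        using less.prems(3)[OF z] by (simp add: norm' n'_def)
    qed
    then show ?thesis using root_orbit_root_refl_iff[OF anisotropic_sub[OF B(1)] y] by simp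
  qed
qed

text \<open>
  Descent on the distance of the hyperplane of \<open>x\<close> from the point \<open>a\<close> of the open cone cut out by \<open>I\<close>. The
  projection \<open>m\<close> of \<open>a\<close> to this hyperplane is not in the cone, so some wall \<open>s\<close> separates them weakly.
  Reflecting in \<open>s\<close> brings the hyperplane closer to \<open>a\<close>, unless it equals the wall.
\<close>

lemma in_orbit_of_walls:
  assumes I: "I \<subseteq> R" and pos: "\<And>s. s \<in> I \<Longrightarrow> aval s a > 0"
    and H: "H \<subseteq> R" "\<And>x s. x \<in> H \<Longrightarrow> s \<in> I \<Longrightarrow> root_refl s x \<in> H"
    and miss: "\<And>x v. x \<in> H \<Longrightarrow> (\<And>s. s \<in> I \<Longrightarrow> aval s v > 0) \<Longrightarrow> aval x v \<noteq> 0"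
    and "x \<in> H"
  shows "x \<in> root_orbit I"
  using \<open>x \<in> H\<close>
proof (induction "card {y \<in> R. \<bar>aval y a\<bar> * norm (fst x) < \<bar>aval x a\<bar> * norm (fst y)}" arbitrary: x rule: less_induct)
  case less
  have xR: "x \<in> R" using less.prems H(1) by auto
  let ?A = "fst x \<bullet> fst x"
  have A: "?A > 0" "norm (fst x) > 0" using fst_R[OF xR] by auto
  define c where "c = aval x a"
  \<comment> \<open>The orthogonal projection of \<open>a\<close> to the hyperplane of \<open>x\<close>.\<close>
  define m where "m = a - (c / ?A) *\<^sub>R fst x"
  have "aval x m = 0" using A by (simp add: aval_def m_def c_def inner_diff_left)
  then obtain s where s: "s \<in> I" and sm: "aval s m \<le> 0" using miss[OF less.prems] by force
  have sR: "s \<in> R" using s I by auto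
  let ?B = "fst s \<bullet> fst s" and ?g = "fst x \<bullet> fst s"
  have B: "?B > 0" "norm (fst s) > 0" using fst_R[OF sR] by auto
  define d where "d = aval s a"
  have d: "d > 0" using pos[OF s] by (simp add: d_def)
  have "aval s m = d - c * ?g / ?A" by (simp add: aval_def m_def d_def inner_diff_left)
  with sm have dc: "d \<le> c * ?g / ?A" by simp
  with d have cg: "c * ?g > 0" using A by (smt (verit) zero_less_divide_iff)
  have cs: "?g\<^sup>2 \<le> ?A * ?B" by (rule Cauchy_Schwarz_ineq)
  let ?e = "2 * d * ?g / ?B"
  have val': "aval (root_refl s x) a = c - ?e"
    by (simp add: root_refl_def aval_diff aval_scaleR cartan_def acoroot_def c_def d_def)
  have "c * ?e = (c * ?g) * (2 * d / ?B)" by simp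
  then have ce: "c * ?e > 0" using cg d B by (metis divide_pos_pos mult_pos_pos zero_less_numeral)
  have dg: "d * (c * ?g) \<le> (c * ?g)\<^sup>2 / ?A"
    using mult_right_mono[OF dc, of "c * ?g"] cg by (simp add: power2_eq_square)
  have cg2: "(c * ?g)\<^sup>2 / ?A \<le> c\<^sup>2 * ?B"
    using mult_left_mono[OF cs, of "c\<^sup>2"] A by (simp add: power_mult_distrib field_simps)
  have ce2: "c * ?e = 2 * (d * (c * ?g)) / ?B" by simp
  have le: "c * ?e \<le> 2 * c\<^sup>2" using dg cg2 B unfolding ce2 by (simp add: field_simps)
  show ?case
  proof (cases "c * ?e = 2 * c\<^sup>2")
    \<comment> \<open>The value at \<open>a\<close> changes from \<open>c\<close> to \<open>c - ?e\<close>, which is smaller in absolute value.\<close>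
    case False
    with le have "c * ?e < 2 * c * c" by (simp add: power2_eq_square)
    then have "(c - ?e)\<^sup>2 < c\<^sup>2"
    proof -
      have "c\<^sup>2 * (c - ?e)\<^sup>2 = (c * c - c * ?e)\<^sup>2" by (simp add: power2_eq_square algebra_simps)
      also have "\<dots> < (c * c)\<^sup>2"
        using ce \<open>c * ?e < 2 * c * c\<close> by (intro abs_le_square_iff[THEN iffD1] power2_strict_mono) auto
      also have "\<dots> = c\<^sup>2 * c\<^sup>2" by (simp add: power2_eq_square)
      finally show ?thesis by (rule mult_left_less_imp_less) simp
    qed
    then have less_abs: "\<bar>aval (root_refl s x) a\<bar> < \<bar>aval x a\<bar>"
      unfolding val' c_def[symmetric] using abs_le_square_iff[of c "c - ?e"] by linarith
    have n': "norm (fst (root_refl s x)) = norm (fst x)"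
      using root_refl_inner[OF fst_R[OF sR], of x x] by (simp add: norm_eq_sqrt_inner)
    have "root_refl s x \<in> root_orbit I"
    proof (rule less.hyps)
      show "root_refl s x \<in> H" using H(2) less.prems s by blast
      let ?S = "\<lambda>x. {y \<in> R. \<bar>aval y a\<bar> * norm (fst x) < \<bar>aval x a\<bar> * norm (fst y)}"
      have "?S x \<subseteq> {y \<in> R. \<bar>aval y a\<bar> \<le> \<bar>aval x a\<bar> / norm (fst x) * norm (fst y)}"
        using A by (auto simp: field_simps)
      then have fin: "finite (?S x)" using locally_finite_R finite_subset by blast
      have "?S (root_refl s x) \<subseteq> ?S x"
      proof
        fix y assume y: "y \<in> ?S (root_refl s x)"
        then have "\<bar>aval (root_refl s x) a\<bar> * norm (fst y) \<le> \<bar>aval x a\<bar> * norm (fst y)"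
          using less_abs by (intro mult_right_mono) auto
        with y show "y \<in> ?S x" unfolding n' by auto
      qed
      moreover have "root_refl s x \<in> ?S x" using less_abs n' A root_refl_R[OF xR sR] by simp
      moreover have "root_refl s x \<notin> ?S (root_refl s x)" by simp
      ultimately have "?S (root_refl s x) \<subset> ?S x" by blast
      with fin show "card (?S (root_refl s x)) < card (?S x)" by (rule psubset_card_mono)
    qed
    then show ?thesis using root_orbit_root_refl_iff[OF anisotropic_sub[OF I] s] by simp
  next
    case True
    then have "2 * (d * (c * ?g)) = 2 * c\<^sup>2 * ?B" using B unfolding ce2 by (simp add: field_simps)
    then have eq: "d * (c * ?g) = (c * ?g)\<^sup>2 / ?A" "(c * ?g)\<^sup>2 / ?A = c\<^sup>2 * ?B" using dg cg2 by auto
    have c0: "c \<noteq> 0" using cg by auto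
    \<comment> \<open>Equality holds in the Cauchy-Schwarz inequality, so the two hyperplanes are parallel, hence equal.\<close>
    from eq(2) A c0 have "?g\<^sup>2 = ?A * ?B" by (simp add: power_mult_distrib field_simps)
    then have par: "fst x = fst s \<or> fst x = - fst s" using parallel_R[OF xR sR] by blast
    from eq(1) cg A have "d = c * ?g / ?A" by (auto simp: power2_eq_square field_simps)
    with par A have "fst x = fst s \<and> d = c \<or> fst x = - fst s \<and> d = - c" by auto
    then have "x = s \<or> x = - s" by (auto simp: c_def d_def aval_def prod_eq_iff)
    moreover have "s \<in> root_orbit I" using s root_orbit_base by blast
    moreover from this have "- s \<in> root_orbit I" by (rule root_orbit_minus[OF anisotropic_sub[OF I]])
    ultimately show ?thesis by metis
  qed
qed

end

section \<open>Roots of a generating set of reflections\<close>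

lemma even_card_of_free_involution:
  assumes "finite A" "\<And>x. x \<in> A \<Longrightarrow> f x \<in> A" "\<And>x. x \<in> A \<Longrightarrow> f (f x) = x" "\<And>x. x \<in> A \<Longrightarrow> f x \<noteq> x"
  shows "even (card A)"
  using assms
proof (induction "card A" arbitrary: A rule: less_induct)
  case less
  show ?case
  proof (cases "A = {}")
    case False
    then obtain x where x: "x \<in> A" by blast
    let ?B = "A - {x, f x}"
    have two: "card {x, f x} = 2" using less.prems(4)[OF x] by simp
    have sub: "{x, f x} \<subseteq> A" using x less.prems(2) by simp
    have c: "card A = card ?B + 2"
      using card_Diff_subset[OF _ sub] card_mono[OF less.prems(1) sub] two by simp
    have "even (card ?B)"
    proof (rule less.hyps)
      show "card ?B < card A" using c by simp
      show "finite ?B" using less.prems(1) by simp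
      fix y assume y: "y \<in> ?B"
      then have "f y \<noteq> x" "f y \<noteq> f x" using less.prems(3) x by (metis DiffE insertCI, metis DiffE insertCI)
      with y show "f y \<in> ?B" using less.prems(2) by blast
      show "f (f y) = y" "f y \<noteq> y" using y less.prems(3,4) by auto
    qed
    with c show ?thesis by simp
  qed simp
qed

context affine_root_set
begin

text \<open>
  Suppose that the set \<open>D\<close> of roots outside \<open>root_orbit Y\<close> is not empty, and count the hyperplanes of
  \<open>D\<close> that separate \<open>a\<close> from its image under a group element. Modulo 2 this count is additive along words,
  because \<open>D\<close> is stable under the group. It is even for a reflection in \<open>Y\<close>, since the reflection acts
  freely on the hyperplanes it counts, and odd for a reflection in a member of \<open>D\<close>, whose own
  hyperplane is the only fixed one. But the reflections in \<open>Y\<close> generate the group.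
\<close>

lemma R_subset_orbit_if_generating:
  assumes Y: "Y \<subseteq> R" and gen: "\<And>x. x \<in> R \<Longrightarrow> arefl x \<in> generated_maps Y"
    and a: "\<And>x. x \<in> R \<Longrightarrow> aval x a \<noteq> 0"
  shows "R \<subseteq> root_orbit Y"
proof (rule ccontr)
  assume "\<not> R \<subseteq> root_orbit Y"
  then obtain y0 where y0: "y0 \<in> R" "y0 \<notin> root_orbit Y" by blast
  have anY: "anisotropic Y" using Y by (rule anisotropic_sub)
  define D where "D = R - root_orbit Y"
  define P where "P u v = {x \<in> D. aval x u > 0 \<and> aval x v < 0}" for u v
  define generic where "generic u \<longleftrightarrow> (\<forall>x\<in>R. aval x u \<noteq> 0)" for u
  have D_minus: "- x \<in> D" if "x \<in> D" for x
    using that by (auto simp: D_def root_orbit_minus_iff[OF anY] intro: minus_R)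
  have D_root_refl: "root_refl y x \<in> D" if "x \<in> D" "y \<in> Y" for x y
    using that Y by (auto simp: D_def root_orbit_root_refl_iff[OF anY] intro: root_refl_R)
  have D_word_act: "word_act ys x \<in> D" if "x \<in> D" "set ys \<subseteq> Y" for x ys
    using that by (induction ys) (auto intro: D_root_refl)
  have D_sr': "root_refl y x \<in> D" if x: "x \<in> D" and y: "y \<in> R" for x y
  proof -
    obtain ys where ys: "set ys \<subseteq> Y" "arefl y = word_map ys" using gen[OF y] by (auto simp: generated_maps_def)
    then have an: "anisotropic (set ys)" using anY anisotropic_subset by blast
    have "aval (root_refl y x) v = aval (word_act (rev ys) x) v" for v
      using aval_word_act[OF an, of "word_act (rev ys) x" v] word_act_rev'[OF an] ys(2) by (simp add: aval_refl[symmetric])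
    then have "root_refl y x = word_act (rev ys) x" by (intro aval_inject ext)
    then show ?thesis using D_word_act[OF x, of "rev ys"] ys(1) by simp
  qed
  have aval_root_refl: "aval (root_refl y x) (arefl y u) = aval x u" if "y \<in> R" for x y u
    using that by (simp add: aval_refl root_refl_involution fst_R)
  have fin: "finite (P u v)" for u v
  proof (rule finite_subset[OF _ locally_finite_R[of u "norm (u - v)"]])
    show "P u v \<subseteq> {x \<in> R. \<bar>aval x u\<bar> \<le> norm (u - v) * norm (fst x)}"
    proof
      fix x assume x: "x \<in> P u v"
      have "aval x u - aval x v = (u - v) \<bullet> fst x" by (simp add: aval_def inner_diff_left)
      also have "\<dots> \<le> norm (u - v) * norm (fst x)" by (rule norm_cauchy_schwarz)
      finally show "x \<in> {x \<in> R. \<bar>aval x u\<bar> \<le> norm (u - v) * norm (fst x)}"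
        using x by (auto simp: P_def D_def)
    qed
  qed
  have generic_arefl: "generic (arefl y u)" if "generic u" "y \<in> R" for u y
    using that unfolding generic_def aval_refl by (blast intro: root_refl_R)
  have generic_word_map: "generic (word_map ys u)" if "generic u" "set ys \<subseteq> Y" for u ys
    using that Y by (induction ys) (auto intro!: generic_arefl)
  have triangle: "even (card (P u v) + card (P v w) + card (P u w))"
    if "generic u" "generic v" "generic w" for u v w
  proof -
    let ?T = "\<lambda>A. {x \<in> D. A x}"
    have split: "card (P r s) = card {x \<in> P r s. aval x t > 0} + card {x \<in> P r s. aval x t < 0}"
      if "generic t" for r s t
    proof -
      have "P r s = {x \<in> P r s. aval x t > 0} \<union> {x \<in> P r s. aval x t < 0}"
        using that by (auto simp: P_def D_def generic_def)
      moreover have "{x \<in> P r s. aval x t > 0} \<inter> {x \<in> P r s. aval x t < 0} = {}" by auto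
      ultimately show ?thesis using fin by (metis (lifting) card_Un_disjoint finite_Un)
    qed
    have "{x \<in> P u w. aval x v > 0} = {x \<in> P v w. aval x u > 0}" by (auto simp: P_def)
    moreover have "{x \<in> P u w. aval x v < 0} = {x \<in> P u v. aval x w < 0}" by (auto simp: P_def)
    moreover have "card {x \<in> P u v. aval x w > 0} = card {x \<in> P v w. aval x u < 0}"
    proof (rule bij_betw_same_card[of uminus])
      show "bij_betw uminus {x \<in> P u v. aval x w > 0} {x \<in> P v w. aval x u < 0}"
        by (rule bij_betw_byWitness[of _ uminus])
          (use D_minus in \<open>auto simp: P_def aval_minus simp del: uminus_Pair\<close>)
    qed
    ultimately show ?thesis
      using split[OF that(3), of u v] split[OF that(1), of v w] split[OF that(2), of u w] by simp blast
  qed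
  have invariant: "card (P (arefl y u) (arefl y v)) = card (P u v)" if y: "y \<in> R" for u v y
  proof (rule bij_betw_same_card[of "root_refl y"])
    show "bij_betw (root_refl y) (P (arefl y u) (arefl y v)) (P u v)"
      by (rule bij_betw_byWitness[of _ "root_refl y"])
        (use y in \<open>auto simp: P_def aval_refl[symmetric] arefl_involution root_refl_involution fst_R D_sr'\<close>)
  qed
  \<comment> \<open>The involution \<open>x \<mapsto> - root_refl y x\<close> pairs the hyperplanes that separate \<open>u\<close> from its mirror image.\<close>
  have fixed: "x = y \<or> x = - y" if "x \<in> R" "y \<in> R" "- root_refl y x = x" for x y
  proof -
    have "2 *\<^sub>R x = cartan x y *\<^sub>R y" using that(3) by (simp add: root_refl_def scaleR_2 algebra_simps)
    then have "(1/2) *\<^sub>R 2 *\<^sub>R x = (1/2) *\<^sub>R cartan x y *\<^sub>R y" by (rule arg_cong)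
    then have x: "x = (cartan x y / 2) *\<^sub>R y" by simp
    then have "cartan x y / 2 = 1 \<or> cartan x y / 2 = - 1"
      using reduced_R[OF that(1,2), of "cartan x y / 2"] by (metis fst_scaleR)
    with x show ?thesis by (metis scaleR_minus1_left scaleR_one)
  qed
  have involution: "- root_refl y x \<in> P u (arefl y u)" "- root_refl y (- root_refl y x) = x"
    if "x \<in> P u (arefl y u)" "y \<in> R" for x y u
    using that by (auto simp: P_def aval_minus aval_refl[symmetric] arefl_involution fst_R
        D_sr' D_minus linear_neg[OF linear_root_refl] root_refl_involution simp del: uminus_Pair)
  have even_Y: "even (card (P u (arefl y u)))" if "y \<in> Y" for y u
  proof (rule even_card_of_free_involution[OF fin, of _ _ "\<lambda>x. - root_refl y x"])
    fix x assume x: "x \<in> P u (arefl y u)"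
    have yR: "y \<in> R" using that Y by auto
    show "- root_refl y x \<in> P u (arefl y u)" "- root_refl y (- root_refl y x) = x" using involution[OF x yR] .
    have xR: "x \<in> R" "x \<notin> root_orbit Y" using x by (auto simp: P_def D_def)
    have "y \<in> root_orbit Y" using root_orbit_base that by blast
    then have "- y \<in> root_orbit Y" by (rule root_orbit_minus[OF anY])
    with \<open>y \<in> root_orbit Y\<close> xR(2) have "x \<noteq> y" "x \<noteq> - y" by metis+
    with fixed[OF xR(1) yR] show "- root_refl y x \<noteq> x" by metis
  qed
  have ga: "generic a" using a by (simp add: generic_def)
  have even_word: "even (card (P a (word_map ys a)))" if "set ys \<subseteq> Y" for ys
    using that
  proof (induction ys)
    case Nil
    have "P a a = {}" by (auto simp: P_def)
    then show ?case by simp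
  next
    case (Cons y ys)
    then have y: "y \<in> Y" "y \<in> R" and ys: "set ys \<subseteq> Y" using Y by auto
    have "even (card (P a (arefl y a)) + card (P (arefl y a) (arefl y (word_map ys a))) + card (P a (arefl y (word_map ys a))))"
      using triangle generic_arefl generic_word_map ga y ys by blast
    then show ?case using even_Y[OF y(1), of a] Cons.IH[OF ys] by (simp add: invariant[OF y(2)])
  qed
  obtain y where y: "y \<in> D" "aval y a > 0"
  proof (cases "aval y0 a > 0")
    case True then show thesis using that y0 by (auto simp: D_def)
  next
    case False
    then have "aval y0 a < 0" using a[OF y0(1)] by linarith
    moreover have "- y0 \<in> D" by (rule D_minus) (simp add: D_def y0)
    ultimately show thesis using that[of "- y0"] by (simp add: aval_minus)
  qed
  have yR: "y \<in> R" using y by (simp add: D_def)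
  have yP: "y \<in> P a (arefl y a)" using y yR by (simp add: P_def aval_refl root_refl_self fst_R aval_minus)
  have "even (card (P a (arefl y a) - {y}))"
  proof (rule even_card_of_free_involution[of _ "\<lambda>x. - root_refl y x"])
    show "finite (P a (arefl y a) - {y})" using fin by simp
    fix x assume x: "x \<in> P a (arefl y a) - {y}"
    then have xP: "x \<in> P a (arefl y a)" and xy: "x \<noteq> y" by auto
    have sy: "- root_refl y y = y" using yR by (simp add: root_refl_self fst_R)
    have "- root_refl y x \<noteq> y"
    proof
      assume "- root_refl y x = y"
      then have "x = - root_refl y y" using involution(2)[OF xP yR] by metis
      with sy xy show False by simp
    qed
    then show "- root_refl y x \<in> P a (arefl y a) - {y}" using involution(1)[OF xP yR] by blast
    show "- root_refl y (- root_refl y x) = x" by (rule involution(2)[OF xP yR])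
    have "x \<in> R" "aval x a > 0" using xP by (auto simp: P_def D_def)
    moreover have "x \<noteq> - y" using y(2) \<open>aval x a > 0\<close> by (auto simp: aval_minus)
    ultimately show "- root_refl y x \<noteq> x" using fixed[OF _ yR] xy by metis
  qed
  then have "odd (card (P a (arefl y a)))"
    using card.remove[OF fin yP] by simp
  moreover obtain ys where "set ys \<subseteq> Y" "arefl y = word_map ys" using gen[OF yR] by (auto simp: generated_maps_def)
  ultimately show False using even_word[of ys] by simp
qed

end

section \<open>The affine roots and the fundamental alcove\<close>

lemma finite_ints_near: "finite {k::int. \<bar>a - real_of_int k\<bar> \<le> b}"
proof (rule finite_subset)
  show "{k. \<bar>a - real_of_int k\<bar> \<le> b} \<subseteq> {\<lfloor>a - b\<rfloor>..\<lceil>a + b\<rceil>}"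
  proof
    fix k assume "k \<in> {k. \<bar>a - real_of_int k\<bar> \<le> b}"
    then have "a - b \<le> real_of_int k" "real_of_int k \<le> a + b" by auto
    then show "k \<in> {\<lfloor>a - b\<rfloor>..\<lceil>a + b\<rceil>}" by (simp add: floor_le_iff le_ceiling_iff)
  qed
qed simp

locale affine_coxeter =
  fixes \<Phi> \<Delta> :: "'a::euclidean_space set" and \<theta> :: 'a
  assumes root_system: "crystallographic_root_system \<Phi>"
    and simple: "simple_system \<Phi> \<Delta>"
    and highest: "highest_root \<Phi> \<Delta> \<theta>"
begin

definition affine_roots :: "('a \<times> real) set" where
  "affine_roots = {(\<alpha>, real_of_int k) | \<alpha> k. \<alpha> \<in> \<Phi>}"

text \<open>
  The highest root enters with negative signs so that all simple affine roots are positive on the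
  fundamental alcove; \<open>arefl (- \<theta>, - 1)\<close> is the reflection in the hyperplane \<open>v \<bullet> \<theta> = 1\<close>.
\<close>

definition simple_roots :: "('a \<times> real) set" where
  "simple_roots = (\<lambda>\<alpha>. (\<alpha>, 0)) ` \<Delta> \<union> {(- \<theta>, - 1)}"

lemma affine_rootE: assumes "x \<in> affine_roots" obtains \<alpha> k where "x = (\<alpha>, real_of_int k)" "\<alpha> \<in> \<Phi>"
  using assms by (auto simp: affine_roots_def)

lemma affine_rootI: "\<alpha> \<in> \<Phi> \<Longrightarrow> (\<alpha>, real_of_int k) \<in> affine_roots"
  by (auto simp: affine_roots_def)

lemma finite_roots: "finite \<Phi>" and nonzero_roots: "0 \<notin> \<Phi>" and span_roots: "span \<Phi> = UNIV"
  using root_system by (auto simp: crystallographic_root_system_def)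

lemma root_multiple: "\<alpha> \<in> \<Phi> \<Longrightarrow> c *\<^sub>R \<alpha> \<in> \<Phi> \<longleftrightarrow> c = 1 \<or> c = - 1"
  using root_system by (auto simp: crystallographic_root_system_def)

lemma root_minus: "\<alpha> \<in> \<Phi> \<Longrightarrow> - \<alpha> \<in> \<Phi>"
  using root_multiple[of \<alpha> "- 1"] by simp

lemma cartan_Ints: "\<alpha> \<in> \<Phi> \<Longrightarrow> \<beta> \<in> \<Phi> \<Longrightarrow> \<beta> \<bullet> coroot \<alpha> \<in> \<int>"
  using root_system by (auto simp: crystallographic_root_system_def)

lemma reflected_root:
  assumes "\<alpha> \<in> \<Phi>" "\<beta> \<in> \<Phi>" shows "\<beta> - (\<beta> \<bullet> coroot \<alpha>) *\<^sub>R \<alpha> \<in> \<Phi>"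
proof -
  have "affine_reflection \<alpha> 0 ` \<Phi> = \<Phi>"
    using root_system assms(1) by (simp add: crystallographic_root_system_def)
  then have "affine_reflection \<alpha> 0 \<beta> \<in> \<Phi>" using assms(2) by blast
  then show ?thesis by (simp add: affine_reflection_def coroot_def mult.commute)
qed

lemma affine_root_set_affine_roots: "affine_root_set affine_roots"
proof
  show "anisotropic affine_roots" using nonzero_roots by (auto simp: anisotropic_def affine_roots_def)
  have cartan: "cartan (\<alpha>, k) (\<beta>, l) = \<alpha> \<bullet> coroot \<beta>" for \<alpha> \<beta> and k l :: real
    by (simp add: cartan_def acoroot_def coroot_def)
  show "cartan x y \<in> \<int>" if "x \<in> affine_roots" "y \<in> affine_roots" for x y
    using that by (auto simp: cartan cartan_Ints elim!: affine_rootE)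
  show "root_refl y x \<in> affine_roots" if xR: "x \<in> affine_roots" and yR: "y \<in> affine_roots" for x y
  proof -
    obtain \<alpha> k where x: "x = (\<alpha>, real_of_int k)" "\<alpha> \<in> \<Phi>" using xR by (rule affine_rootE)
    obtain \<beta> l where y: "y = (\<beta>, real_of_int l)" "\<beta> \<in> \<Phi>" using yR by (rule affine_rootE)
    note xy = x y
    obtain m where m: "\<alpha> \<bullet> coroot \<beta> = real_of_int m" using cartan_Ints[OF xy(4,2)] by (auto elim: Ints_cases)
    have "root_refl y x = (\<alpha> - (\<alpha> \<bullet> coroot \<beta>) *\<^sub>R \<beta>, real_of_int (k - m * l))"
      by (simp add: root_refl_def xy(1,3) cartan m)
    then show ?thesis using reflected_root[OF xy(4,2)] affine_rootI by presburger
  qed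
  show "c = 1 \<or> c = - 1" if "x \<in> affine_roots" "y \<in> affine_roots" "fst x = c *\<^sub>R fst y" for x y c
    using that root_multiple[of "fst y" c] by (auto elim!: affine_rootE)
  show "finite {x \<in> affine_roots. \<bar>aval x v\<bar> \<le> c * norm (fst x)}" for v c
  proof (rule finite_subset)
    show "{x \<in> affine_roots. \<bar>aval x v\<bar> \<le> c * norm (fst x)} \<subseteq>
      (\<Union>\<alpha>\<in>\<Phi>. (\<lambda>k. (\<alpha>, real_of_int k)) ` {k. \<bar>v \<bullet> \<alpha> - real_of_int k\<bar> \<le> c * norm \<alpha>})"
      by (auto simp: aval_def elim!: affine_rootE)
  qed (use finite_roots finite_ints_near in auto)
qed

sublocale affine_root_set affine_roots by (rule affine_root_set_affine_roots)

lemma simple_subset: "\<Delta> \<subseteq> \<Phi>" and independent_simple: "independent \<Delta>" and span_simple: "span \<Delta> = UNIV"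
  using simple span_roots by (auto simp: simple_system_def)

lemma finite_simple: "finite \<Delta>" using simple_subset finite_roots finite_subset by blast

lemma highest_in: "\<theta> \<in> \<Phi>" using highest by (simp add: highest_root_def)

lemma simple_roots_affine_roots: "simple_roots \<subseteq> affine_roots"
  using simple_subset affine_rootI[of _ 0] affine_rootI[OF root_minus[OF highest_in], of "- 1"] by (auto simp: simple_roots_def)

lemma finite_simple_roots: "finite simple_roots" using finite_simple by (simp add: simple_roots_def)

lemma independent_simple_roots: "independent simple_roots"
proof -
  let ?f = "\<lambda>\<alpha>::'a. (\<alpha>, 0::real)"
  have lin: "linear ?f" by (rule linearI) auto
  have "independent (?f ` \<Delta>)"
    by (rule linear_independent_injective_image[OF lin independent_simple]) (auto intro: inj_onI)
  moreover have "(- \<theta>, - 1) \<notin> span (?f ` \<Delta>)"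
    by (auto simp: linear_span_image[OF lin])
  ultimately show ?thesis by (simp add: simple_roots_def independent_insertI)
qed

lemma card_simple_roots: "card simple_roots = DIM('a \<times> real)"
proof -
  have "card \<Delta> = DIM('a)" using independent_simple span_simple by (metis dim_UNIV dim_span_eq_card_independent)
  moreover have "card ((\<lambda>\<alpha>. (\<alpha>, 0::real)) ` \<Delta>) = card \<Delta>" by (rule card_image) (auto intro: inj_onI)
  moreover have "(- \<theta>, - 1::real) \<notin> (\<lambda>\<alpha>. (\<alpha>, 0)) ` \<Delta>" by auto
  ultimately show ?thesis using finite_simple by (simp add: simple_roots_def)
qed

lemma span_simple_roots: "span simple_roots = UNIV"
  using independent_simple_roots card_simple_roots by (metis dim_eq_full dim_eq_card_independent)

definition alcove :: "'a set" where "alcove = {v. \<forall>s\<in>simple_roots. aval s v > 0}"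

lemma alcove_iff: "v \<in> alcove \<longleftrightarrow> (\<forall>\<alpha>\<in>\<Delta>. v \<bullet> \<alpha> > 0) \<and> v \<bullet> \<theta> < 1"
  by (auto simp: alcove_def simple_roots_def aval_def)

lemma alcove_nonempty: obtains a where "a \<in> alcove"
proof -
  obtain f :: 'a where f: "\<And>\<alpha>. \<alpha> \<in> \<Delta> \<Longrightarrow> f \<bullet> \<alpha> = 1"
    using exists_inner_prescribed[OF independent_simple, of "\<lambda>_. 1"] by metis
  \<comment> \<open>Shrinking \<open>f\<close> keeps it positive on the simple roots and brings the highest root below 1.\<close>
  let ?e = "1 / (1 + \<bar>f \<bullet> \<theta>\<bar>)"
  have e: "?e > 0" by (simp add: add_pos_nonneg)
  have "?e * (f \<bullet> \<theta>) < 1" by (simp add: field_simps)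
  then have "?e *\<^sub>R f \<in> alcove" using e f by (auto simp: alcove_iff)
  then show thesis by (rule that)
qed

lemma positive_root_on_alcove:
  assumes v: "v \<in> alcove" and "\<beta> \<in> \<Phi>" "nonneg_combination \<Delta> \<beta>"
  shows "0 < v \<bullet> \<beta>" "v \<bullet> \<beta> < 1"
proof -
  have nonneg: "0 \<le> v \<bullet> \<gamma>" if "nonneg_combination \<Delta> \<gamma>" for \<gamma>
    using that v by (auto simp: nonneg_combination_def inner_sum_right alcove_iff less_imp_le intro!: sum_nonneg mult_nonneg_nonneg)
  obtain c where c: "\<beta> = (\<Sum>\<alpha>\<in>\<Delta>. real (c \<alpha>) *\<^sub>R \<alpha>)" using assms(3) by (auto simp: nonneg_combination_def)
  have "\<beta> \<noteq> 0" using assms(2) nonzero_roots by auto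
  then obtain \<alpha> where \<alpha>: "\<alpha> \<in> \<Delta>" "c \<alpha> \<noteq> 0" using c by (metis (no_types, lifting) of_nat_0 scaleR_zero_left sum.neutral)
  have "0 < (\<Sum>\<alpha>\<in>\<Delta>. real (c \<alpha>) * (v \<bullet> \<alpha>))"
    by (rule sum_pos2[OF finite_simple \<alpha>(1)]) (use \<alpha> v in \<open>auto simp: alcove_iff less_imp_le\<close>)
  then show "0 < v \<bullet> \<beta>" by (simp add: c inner_sum_right)
  have "0 \<le> v \<bullet> (\<theta> - \<beta>)" using highest assms(2) nonneg by (simp add: highest_root_def)
  then show "v \<bullet> \<beta> < 1" using v by (simp add: inner_diff_right alcove_iff)
qed

text \<open>
  On the alcove a positive root takes values strictly between 0 and 1, by comparison with the highest root.
\<close>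

lemma root_nonzero_on_alcove:
  assumes v: "v \<in> alcove" and "x \<in> affine_roots" shows "aval x v \<noteq> 0"
proof
  assume "aval x v = 0"
  obtain \<beta> k where x: "x = (\<beta>, real_of_int k)" "\<beta> \<in> \<Phi>" using assms(2) by (rule affine_rootE)
  then have k: "v \<bullet> \<beta> = real_of_int k" using \<open>aval x v = 0\<close> by (simp add: aval_def)
  consider "nonneg_combination \<Delta> \<beta>" | "nonneg_combination \<Delta> (- \<beta>)"
    using simple x(2) by (auto simp: simple_system_def)
  then show False
  proof cases
    case 1 then show False using positive_root_on_alcove[OF v x(2)] k by simp
  next
    case 2 then show False using positive_root_on_alcove[OF v root_minus[OF x(2)]] k by simp
  qed
qed

text \<open>
  No hyperplane meets the open alcove, so the descent applies to all affine roots at once. It follows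
  that the simple reflections generate the affine Weyl group.
\<close>

lemma affine_roots_orbit_simple_roots: "affine_roots \<subseteq> root_orbit simple_roots"
proof (rule subsetI)
  fix x assume x: "x \<in> affine_roots"
  obtain a where a: "a \<in> alcove" by (rule alcove_nonempty)
  show "x \<in> root_orbit simple_roots"
    by (rule in_orbit_of_walls[OF simple_roots_affine_roots, of a affine_roots])
      (use a x simple_roots_affine_roots root_nonzero_on_alcove in \<open>auto simp: alcove_def intro!: root_refl_R\<close>)
qed

lemma perturb_positive:
  fixes A B :: "'b \<Rightarrow> real"
  assumes "finite S" "\<And>s. s \<in> S \<Longrightarrow> A s > 0"
  obtains e where "0 < e" "\<And>s. s \<in> S \<Longrightarrow> A s + e * B s > 0"
proof -
  have "\<forall>\<^sub>F e in at_right 0. \<forall>s\<in>S. A s + e * B s > 0"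
  proof (rule eventually_ball_finite[OF assms(1)], rule ballI)
    fix s assume s: "s \<in> S"
    have "((\<lambda>e. A s + e * B s) \<longlongrightarrow> A s + 0 * B s) (at_right 0)" by (intro tendsto_intros)
    then show "\<forall>\<^sub>F e in at_right 0. A s + e * B s > 0" using assms(2)[OF s] by (intro order_tendstoD) auto
  qed
  then have "\<forall>\<^sub>F e in at_right 0. 0 < e \<and> (\<forall>s\<in>S. A s + e * B s > 0)"
    using eventually_at_right_less[of "0::real"] by (rule eventually_conj[rotated])
  then obtain e where "0 < e \<and> (\<forall>s\<in>S. A s + e * B s > 0)" using eventually_happens'[OF trivial_limit_at_right_real] by blast
  then show thesis using that by blast
qed

text \<open>
  A hyperplane through \<open>q\<close> that met the open cone of the walls through \<open>q\<close> would meet the alcove close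
  to \<open>q\<close>, since the remaining walls stay away from \<open>q\<close>.
\<close>

lemma stabilizer_roots:
  assumes q: "\<And>s. s \<in> simple_roots \<Longrightarrow> aval s q \<ge> 0"
  shows "{x \<in> affine_roots. aval x q = 0} \<subseteq> root_orbit {s \<in> simple_roots. aval s q = 0}"
proof (rule subsetI)
  let ?I = "{s \<in> simple_roots. aval s q = 0}" and ?H = "{x \<in> affine_roots. aval x q = 0}"
  fix x assume x: "x \<in> ?H"
  obtain a where a: "a \<in> alcove" by (rule alcove_nonempty)
  show "x \<in> root_orbit ?I"
  proof (rule in_orbit_of_walls[of ?I a ?H])
    show "?I \<subseteq> affine_roots" "?H \<subseteq> affine_roots" using simple_roots_affine_roots by auto
    show "aval s a > 0" if "s \<in> ?I" for s using that a by (simp add: alcove_def)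
    show "root_refl s y \<in> ?H" if "y \<in> ?H" "s \<in> ?I" for y s
      using that simple_roots_affine_roots by (auto simp: root_refl_def aval_diff aval_scaleR intro: root_refl_R[unfolded root_refl_def])
    show "x \<in> ?H" by (rule x)
    fix y v assume y: "y \<in> ?H" and v: "\<And>s. s \<in> ?I \<Longrightarrow> aval s v > 0"
    let ?J = "{s \<in> simple_roots. aval s q > 0}"
    obtain e where e: "0 < e" "\<And>s. s \<in> ?J \<Longrightarrow> aval s q + e * (aval s v - aval s q) > 0"
    proof (rule perturb_positive[of ?J "\<lambda>s. aval s q" "\<lambda>s. aval s v - aval s q"])
      show "finite ?J" using finite_simple_roots by simp
    qed auto
    let ?u = "q + e *\<^sub>R (v - q)"
    have u: "aval z ?u = aval z q + e * (aval z v - aval z q)" for z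
      by (simp add: aval_def inner_add_left inner_diff_left)
    have "?u \<in> alcove"
      unfolding alcove_def
    proof (intro CollectI ballI)
      fix s assume s: "s \<in> simple_roots"
      show "0 < aval s ?u"
      proof (cases "aval s q = 0")
        case True then show ?thesis using s v e(1) by (simp add: u)
      next
        case False then show ?thesis using s q[OF s] e(2)[of s] by (simp add: u)
      qed
    qed
    then have "aval y ?u \<noteq> 0" using root_nonzero_on_alcove y by blast
    then show "aval y v \<noteq> 0" using y by (auto simp: u)
  qed
qed

lemma no_common_zero: obtains x where "x \<in> affine_roots" "aval x p \<noteq> 0"
proof (cases "aval (\<theta>, 0) p = 0")
  case True
  then show thesis using that[of "(\<theta>, 1)"] affine_rootI[OF highest_in, of 1] by (simp add: aval_def)
next
  case False
  then show thesis using that[of "(\<theta>, 0)"] affine_rootI[OF highest_in, of 0] by simp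
qed

lemma aval_word_map: "set us \<subseteq> affine_roots \<Longrightarrow> aval x (word_map us p) = aval (word_act (rev us) x) p"
  using aval_word_act[of us "word_act (rev us) x" p] by (simp add: word_act_rev' anisotropic_sub)

text \<open>
  The number \<open>v \<bullet> \<alpha>\<close> differs from one of the finitely many \<open>p \<bullet> \<gamma>\<close> by an integer whenever \<open>v\<close> is in the
  orbit of \<open>p\<close>, and the products with the simple roots determine \<open>v\<close>.
\<close>

lemma finite_orbit_in_ball:
  "finite {v. (\<exists>us. set us \<subseteq> simple_roots \<and> v = word_map us p) \<and> norm (v - a) \<le> r}" (is "finite ?O")
proof -
  define E where "E \<alpha> = (\<Union>\<gamma>\<in>\<Phi>. (\<lambda>k. p \<bullet> \<gamma> - real_of_int k) ` {k. \<bar>(p \<bullet> \<gamma> - a \<bullet> \<alpha>) - real_of_int k\<bar> \<le> r * norm \<alpha>})" for \<alpha>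
  have finE: "finite (E \<alpha>)" for \<alpha> unfolding E_def using finite_roots finite_ints_near by auto
  define f where "f v = (\<lambda>\<alpha>\<in>\<Delta>. v \<bullet> \<alpha>)" for v
  have coords: "v \<bullet> \<alpha> \<in> E \<alpha>" if v: "v \<in> ?O" and \<alpha>: "\<alpha> \<in> \<Delta>" for v \<alpha>
  proof -
    from v obtain us where us: "set us \<subseteq> simple_roots" "v = word_map us p" by auto
    have "(\<alpha>, 0) \<in> affine_roots" using \<alpha> simple_subset affine_rootI[of \<alpha> 0] by auto
    then have "word_act (rev us) (\<alpha>, 0) \<in> affine_roots" using us(1) simple_roots_affine_roots by (intro word_act_R) auto
    then obtain \<gamma> k where g: "word_act (rev us) (\<alpha>, 0) = (\<gamma>, real_of_int k)" "\<gamma> \<in> \<Phi>" by (rule affine_rootE)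
    have "v \<bullet> \<alpha> = aval (\<alpha>, 0) v" by (simp add: aval_def)
    also have "\<dots> = p \<bullet> \<gamma> - real_of_int k" using aval_word_map[of us "(\<alpha>, 0)" p] us simple_roots_affine_roots g by (auto simp: aval_def)
    finally have va: "v \<bullet> \<alpha> = p \<bullet> \<gamma> - real_of_int k" .
    have "\<bar>v \<bullet> \<alpha> - a \<bullet> \<alpha>\<bar> \<le> norm (v - a) * norm \<alpha>"
      using Cauchy_Schwarz_ineq2[of "v - a" \<alpha>] by (simp add: inner_diff_left)
    also have "\<dots> \<le> r * norm \<alpha>" using v by (auto intro: mult_right_mono)
    finally have "\<bar>(p \<bullet> \<gamma> - a \<bullet> \<alpha>) - real_of_int k\<bar> \<le> r * norm \<alpha>" unfolding va by (simp add: algebra_simps)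
    then show ?thesis using g(2) va unfolding E_def by blast
  qed
  define S where "S = ?O"
  have "f v \<in> PiE \<Delta> E" if "v \<in> S" for v
    using coords that by (simp add: f_def S_def)
  then have "f ` S \<subseteq> PiE \<Delta> E" by blast
  then have "finite (f ` S)" by (rule finite_subset) (rule finite_PiE[OF finite_simple finE])
  moreover have "inj_on f S"
  proof (rule inj_onI)
    fix v w assume "f v = f w"
    have "v \<bullet> \<alpha> = w \<bullet> \<alpha>" if "\<alpha> \<in> \<Delta>" for \<alpha> using fun_cong[OF \<open>f v = f w\<close>, of \<alpha>] that by (simp add: f_def)
    then have "\<forall>\<alpha>\<in>\<Delta>. (v - w) \<bullet> \<alpha> = 0" by (simp add: inner_diff_left)
    then have "orthogonal (v - w) x" if "x \<in> span \<Delta>" for x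
      using orthogonal_to_span[OF that] by (auto simp: orthogonal_def)
    then have "orthogonal (v - w) (v - w)" using span_simple by auto
    then show "v = w" by (simp add: orthogonal_def)
  qed
  ultimately have "finite S" by (rule finite_imageD)
  then show ?thesis by (simp only: S_def)
qed

text \<open>
  A point of the orbit at minimal distance from a point of the alcove lies on its side of every wall.
\<close>

lemma orbit_meets_closed_alcove:
  obtains us where "set us \<subseteq> simple_roots" "\<And>s. s \<in> simple_roots \<Longrightarrow> aval s (word_map us p) \<ge> 0"
proof -
  obtain a where a: "a \<in> alcove" by (rule alcove_nonempty)
  let ?O = "{v. (\<exists>us. set us \<subseteq> simple_roots \<and> v = word_map us p) \<and> norm (v - a) \<le> norm (p - a)}"
  have "p \<in> ?O" by (auto intro: exI[of _ "[]"])
  then have ne: "?O \<noteq> {}" by blast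
  have fin: "finite ?O" by (rule finite_orbit_in_ball)
  define v where "v = arg_min_on (\<lambda>v. norm (v - a)) ?O"
  have v: "v \<in> ?O" unfolding v_def by (rule arg_min_if_finite[OF fin ne])
  have min: "norm (v - a) \<le> norm (u - a)" if "u \<in> ?O" for u
    unfolding v_def using arg_min_least[OF fin ne that] .
  obtain us where us: "set us \<subseteq> simple_roots" "v = word_map us p" using v by auto
  have "aval s v \<ge> 0" if s: "s \<in> simple_roots" for s
  proof (rule ccontr)
    assume "\<not> aval s v \<ge> 0"
    then have neg: "aval s v < 0" by simp
    have sa: "aval s a > 0" using a s by (simp add: alcove_def)
    let ?b = "fst s \<bullet> fst s"
    have b: "?b > 0" using s simple_roots_affine_roots fst_R[of s] by auto
    define t where "t = aval s v * (2 / ?b)"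
    have tneg: "t < 0" unfolding t_def using neg b by (intro mult_neg_pos divide_pos_pos) auto
    have tb: "t * ?b = 2 * aval s v" using b by (simp add: t_def)
    have r: "arefl s v - a = (v - a) - t *\<^sub>R fst s" by (simp add: arefl_def acoroot_def t_def)
    have va: "(v - a) \<bullet> fst s = aval s v - aval s a" by (simp add: aval_def inner_diff_left)
    have "(norm (arefl s v - a))\<^sup>2 = (norm (v - a))\<^sup>2 - 2 * t * ((v - a) \<bullet> fst s) + t * (t * ?b)"
      unfolding r power2_norm_eq_inner by (simp add: inner_diff_left inner_diff_right inner_commute algebra_simps)
    also have "\<dots> = (norm (v - a))\<^sup>2 + 2 * t * aval s a" unfolding tb va by (simp add: algebra_simps)
    finally have "(norm (arefl s v - a))\<^sup>2 < (norm (v - a))\<^sup>2" using tneg sa by (simp add: mult_neg_pos)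
    then have lt: "norm (arefl s v - a) < norm (v - a)" by (rule power2_less_imp_less) simp
    have "arefl s v = word_map (s # us) p" by (simp add: us)
    then have "arefl s v \<in> ?O" using lt v us s by (intro CollectI conjI exI[of _ "s # us"]) auto
    then show False using min lt by fastforce
  qed
  then show thesis using that us by blast
qed

text \<open>
  If the missing root is \<open>(\<gamma>, 0)\<close>, the point is a multiple of the vector dual to \<open>\<gamma>\<close>; the multiple exists because
  \<open>\<gamma>\<close> occurs in the highest root.
\<close>

lemma proper_subset_fixes_point:
  assumes "J \<subset> simple_roots" obtains p where "\<And>s. s \<in> J \<Longrightarrow> aval s p = 0"
proof -
  obtain s0 where s0: "s0 \<in> simple_roots" "s0 \<notin> J" using assms by blast
  show thesis
  proof (cases "s0 = (- \<theta>, - 1)")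
    case True
    then have "J \<subseteq> (\<lambda>\<alpha>. (\<alpha>, 0)) ` \<Delta>" using s0 assms by (auto simp: simple_roots_def)
    then show thesis by (intro that[of 0]) (auto simp: aval_def)
  next
    case False
    then obtain \<gamma> where g: "\<gamma> \<in> \<Delta>" "s0 = (\<gamma>, 0)" using s0 by (auto simp: simple_roots_def)
    obtain h :: 'a where h: "\<And>\<alpha>. \<alpha> \<in> \<Delta> \<Longrightarrow> h \<bullet> \<alpha> = (if \<alpha> = \<gamma> then 1 else 0)"
      using exists_inner_prescribed[OF independent_simple, of "\<lambda>\<alpha>. if \<alpha> = \<gamma> then 1 else 0"] by metis
    obtain c where c: "\<theta> - \<gamma> = (\<Sum>\<alpha>\<in>\<Delta>. real (c \<alpha>) *\<^sub>R \<alpha>)"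
      using highest g simple_subset unfolding highest_root_def nonneg_combination_def by blast
    have "h \<bullet> (\<theta> - \<gamma>) \<ge> 0"
      unfolding c inner_sum_right by (intro sum_nonneg) (simp add: h)
    then have ht: "h \<bullet> \<theta> > 0" using h[OF g(1)] by (simp add: inner_diff_right)
    show thesis
    proof (rule that[of "(1 / (h \<bullet> \<theta>)) *\<^sub>R h"])
      fix s assume s: "s \<in> J"
      then have "s \<in> simple_roots" "s \<noteq> s0" using assms s0 by auto
      then show "aval s ((1 / (h \<bullet> \<theta>)) *\<^sub>R h) = 0"
        using ht h g by (auto simp: simple_roots_def aval_def split: if_splits)
    qed
  qed
qed

end

section \<open>Elliptic elements and fixators of affine subspaces\<close>

lemma independent_coeffs:
  fixes a b :: "'b::real_vector \<Rightarrow> real"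
  assumes "independent S" "finite S" "(\<Sum>y\<in>S. a y *\<^sub>R y) = (\<Sum>y\<in>S. b y *\<^sub>R y)" "y \<in> S"
  shows "a y = b y"
proof -
  have "(\<Sum>y\<in>S. (a y - b y) *\<^sub>R y) = 0" using assms(3) by (simp add: scaleR_diff_left sum_subtractf)
  then have "a y - b y = 0" using real_vector.independentD[OF assms(1,2) order_refl _ assms(4), of "\<lambda>y. a y - b y"] by simp
  then show ?thesis by simp
qed

lemma root_orbit_subset_span: "root_orbit Y \<subseteq> span Y"
proof -
  have "word_act ys y \<in> span Y" if "set ys \<subseteq> Y" "y \<in> Y" for ys y
    using that by (induction ys) (auto simp: span_base root_refl_def intro!: span_diff span_scale)
  then show ?thesis unfolding root_orbit_def by blast
qed

context affine_root_set
begin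

lemma root_orbit_subset_zspan:
  assumes "Y \<subseteq> R" "finite Y"
  shows "root_orbit Y \<subseteq> zspan Y" "acoroot ` root_orbit Y \<subseteq> zspan (acoroot ` Y)"
proof -
  have "word_act ys y \<in> zspan Y \<and> acoroot (word_act ys y) \<in> zspan (acoroot ` Y)" if "set ys \<subseteq> Y" "y \<in> Y" for ys y
    using that
  proof (induction ys)
    case Nil
    then show ?case using assms by (simp add: zspan_base)
  next
    case (Cons z ys)
    let ?x = "word_act ys y"
    have z: "z \<in> Y" "z \<in> R" and x: "?x \<in> R" using Cons.prems assms word_act_R[of ys y] by auto
    have "acoroot (root_refl z ?x) = acoroot ?x - cartan z ?x *\<^sub>R acoroot z"
      using fst_R[OF z(2)] by (simp add: acoroot_root_refl) (simp add: root_refl_def cartan_def acoroot_def inner_commute)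
    moreover have "cartan ?x z \<in> \<int>" "cartan z ?x \<in> \<int>" using cartan_R z x by auto
    moreover have "z \<in> zspan Y" "acoroot z \<in> zspan (acoroot ` Y)" using z assms by (auto intro!: zspan_base)
    ultimately show ?case
      using Cons by (simp add: root_refl_def[of z ?x] zspan_diff zspan_scaleR_Ints)
  qed
  then show "root_orbit Y \<subseteq> zspan Y" "acoroot ` root_orbit Y \<subseteq> zspan (acoroot ` Y)" unfolding root_orbit_def by blast+
qed

end

context affine_coxeter
begin

text \<open>
  An element that fixes \<open>p\<close> is determined by its linear part, which permutes the finitely many roots.
\<close>

lemma finite_order_if_fixed_point:
  assumes us: "set us \<subseteq> affine_roots" and p: "word_map us p = p"
  obtains n where "n > 0" "word_map us ^^ n = id"
proof -
  have an: "anisotropic (set us)" using us by (rule anisotropic_sub)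
  define A where "A \<alpha> = fst (word_act us (\<alpha>, 0))" for \<alpha>
  have inner: "(word_map us v - p) \<bullet> A \<alpha> = (v - p) \<bullet> \<alpha>" for v \<alpha>
    using word_map_diff[of us v p 0] p word_act_inner[OF an, of "(v - p, 0)" "(\<alpha>, 0)"] by (simp add: A_def)
  have A_in: "A \<alpha> \<in> \<Phi>" if "\<alpha> \<in> \<Phi>" for \<alpha>
    using word_act_R[OF us affine_rootI[OF that, of 0]] by (auto simp: A_def elim!: affine_rootE)
  define f where "f \<alpha> = (if \<alpha> \<in> \<Phi> then A \<alpha> else \<alpha>)" for \<alpha>
  have inj: "inj_on A \<Phi>"
  proof (rule inj_onI)
    fix \<alpha> \<beta> assume "A \<alpha> = A \<beta>"
    then have "fst (word_act us (\<alpha> - \<beta>, 0)) = 0"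
      using linear_diff[OF linear_word_act[of us], of "(\<alpha>, 0)" "(\<beta>, 0)"] by (simp add: A_def)
    then show "\<alpha> = \<beta>" using word_act_inner[OF an, of "(\<alpha> - \<beta>, 0)" "(\<alpha> - \<beta>, 0)"] by simp
  qed
  have "f permutes \<Phi>"
  proof (rule bij_imp_permutes)
    have "inj_on f \<Phi>" using inj by (auto simp: f_def inj_on_def)
    moreover have "f ` \<Phi> \<subseteq> \<Phi>" using A_in by (auto simp: f_def)
    ultimately show "bij_betw f \<Phi> \<Phi>"
      using finite_roots by (simp add: bij_betw_def endo_inj_surj)
  qed (simp add: f_def)
  then have "permutation f" using finite_roots permutation_permutes by blast
  then obtain n where n: "n > 0" "f ^^ n = id" using permutation_is_nilpotent[of f] by blast
  have "((word_map us ^^ k) v - p) \<bullet> (f ^^ k) \<alpha> = (v - p) \<bullet> \<alpha> \<and> (f ^^ k) \<alpha> \<in> \<Phi>" if "\<alpha> \<in> \<Phi>" for \<alpha> v k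
    using that
  proof (induction k)
    case (Suc k)
    then show ?case by (simp add: f_def[of "(f ^^ k) \<alpha>"] inner A_in)
  qed simp
  from this[where k = n] have eq: "((word_map us ^^ n) v - p) \<bullet> \<alpha> = (v - p) \<bullet> \<alpha>" if "\<alpha> \<in> \<Phi>" for v \<alpha>
    using that n(2) by simp
  have "(word_map us ^^ n) v = v" for v
  proof -
    let ?d = "(word_map us ^^ n) v - v"
    have "?d \<bullet> \<alpha> = 0" if "\<alpha> \<in> \<Phi>" for \<alpha> using eq[OF that, of v] by (simp add: inner_diff_left)
    then have "orthogonal ?d x" if "x \<in> span \<Phi>" for x
      using orthogonal_to_span[OF that] by (auto simp: orthogonal_def)
    then have "orthogonal ?d ?d" using span_roots by auto
    then show ?thesis by (simp add: orthogonal_def)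
  qed
  then have "word_map us ^^ n = id" by (intro ext) simp
  with n(1) show thesis by (rule that)
qed

end

text \<open>
  The barycentre of an orbit is fixed by an affine map.
\<close>

lemma fixed_point_if_finite_order:
  fixes us :: "('a::euclidean_space \<times> real) list"
  assumes "n > 0" "word_map us ^^ n = id"
  obtains p where "word_map us p = p"
proof -
  let ?x = "word_map us"
  define L where "L v = fst (word_act us (v, 0))" for v
  have lin: "linear L"
  proof (rule linearI)
    fix u v :: 'a and c :: real
    show "L (u + v) = L u + L v"
      using linear_add[OF linear_word_act[of us], of "(u, 0)" "(v, 0)"] by (simp add: L_def)
    show "L (c *\<^sub>R u) = c *\<^sub>R L u"
      using linear_cmul[OF linear_word_act[of us], of c "(u, 0)"] by (simp add: L_def)
  qed
  have x: "?x v = ?x 0 + L v" for v using word_map_diff[of us v 0 0] by (simp add: L_def algebra_simps)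
  define c where "c i = (?x ^^ i) 0" for i
  have c_Suc: "c (Suc i) = ?x 0 + L (c i)" for i using x[of "c i"] by (simp add: c_def)
  let ?s = "\<Sum>i<n. c i"
  have "real n *\<^sub>R ?x 0 + L ?s = (\<Sum>i<n. ?x 0 + L (c i))"
    by (simp add: sum.distrib linear_sum[OF lin] sum_constant_scaleR)
  also have "\<dots> = (\<Sum>i<n. c (Suc i))" by (simp only: c_Suc)
  also have "\<dots> = ?s + (\<Sum>i<n. c (Suc i) - c i)" by (simp add: sum_subtractf)
  also have "(\<Sum>i<n. c (Suc i) - c i) = 0" unfolding sum_lessThan_telescope using assms(2) by (simp add: c_def)
  finally have s: "real n *\<^sub>R ?x 0 + L ?s = ?s" by simp
  have "?x ((1 / real n) *\<^sub>R ?s) = ?x 0 + (1 / real n) *\<^sub>R L ?s"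
    by (subst x) (simp add: linear_cmul[OF lin])
  also have "\<dots> = (1 / real n) *\<^sub>R (real n *\<^sub>R ?x 0 + L ?s)" using assms(1) by (simp add: scaleR_add_right)
  finally show thesis using s that by metis
qed

context affine_coxeter
begin

lemma non_integral_point:
  assumes "finite A" "\<And>y. y \<in> B \<Longrightarrow> aval y p0 = 0" "\<And>\<alpha>. \<alpha> \<in> A \<Longrightarrow> \<alpha> \<notin> span (fst ` B)"
  shows "\<exists>p::'a. (\<forall>y\<in>B. aval y p = 0) \<and> (\<forall>\<alpha>\<in>A. p \<bullet> \<alpha> \<notin> \<int>)"
  using assms
proof (induction A rule: finite_induct)
  case empty
  then show ?case by blast
next
  case (insert \<alpha> A)
  then obtain p where p: "\<forall>y\<in>B. aval y p = 0" "\<forall>\<alpha>\<in>A. p \<bullet> \<alpha> \<notin> \<int>" by auto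
  obtain u e where ue: "u \<in> span (fst ` B)" "\<And>w. w \<in> span (fst ` B) \<Longrightarrow> orthogonal e w" "\<alpha> = u + e"
    using orthogonal_subspace_decomp_exists[of "fst ` B" \<alpha>] by metis
  have "e \<noteq> 0" using ue insert.prems(2)[of \<alpha>] by auto
  moreover have "e \<bullet> \<alpha> = e \<bullet> e" using ue by (simp add: inner_add_right orthogonal_def)
  ultimately have ea: "e \<bullet> \<alpha> > 0" by simp
  have aval: "aval y (p + t *\<^sub>R e) = 0" if "y \<in> B" for y t
    using that p(1) ue(2)[of "fst y"] by (simp add: aval_def inner_add_left orthogonal_def span_base)
  have stay: "\<forall>\<^sub>F t in at_right 0. (p + t *\<^sub>R e) \<bullet> \<beta> \<notin> \<int>" if "p \<bullet> \<beta> \<notin> \<int>" for \<beta>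
  proof -
    have "((\<lambda>t. (p + t *\<^sub>R e) \<bullet> \<beta>) \<longlongrightarrow> (p + 0 *\<^sub>R e) \<bullet> \<beta>) (at_right 0)" by (intro tendsto_intros)
    moreover have "open (- \<int> :: real set)" using closed_Ints by (simp add: open_closed)
    ultimately show ?thesis using topological_tendstoD[of _ "p \<bullet> \<beta>" _ "- \<int>"] that by fastforce
  qed
  have "\<forall>\<^sub>F t in at_right 0. \<forall>\<beta>\<in>A. (p + t *\<^sub>R e) \<bullet> \<beta> \<notin> \<int>"
    by (rule eventually_ball_finite[OF insert.hyps(1)]) (use p(2) stay in blast)
  moreover have "\<forall>\<^sub>F t in at_right 0. (p + t *\<^sub>R e) \<bullet> \<alpha> \<notin> \<int>"
  proof (cases "p \<bullet> \<alpha> \<in> \<int>")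
    case False then show ?thesis by (rule stay)
  next
    case True
    have "((\<lambda>t. t * (e \<bullet> \<alpha>)) \<longlongrightarrow> 0 * (e \<bullet> \<alpha>)) (at_right 0)" by (intro tendsto_intros)
    then have "\<forall>\<^sub>F t in at_right 0. t * (e \<bullet> \<alpha>) < 1" by (rule order_tendstoD) simp
    with eventually_at_right_less[of "0::real"] show ?thesis
    proof eventually_elim
      case (elim t)
      then have t: "0 < t * (e \<bullet> \<alpha>)" "t * (e \<bullet> \<alpha>) < 1" using ea by auto
      show ?case
      proof
        assume "(p + t *\<^sub>R e) \<bullet> \<alpha> \<in> \<int>"
        then have "(p + t *\<^sub>R e) \<bullet> \<alpha> - p \<bullet> \<alpha> \<in> \<int>" using True by (rule Ints_diff)
        then have "t * (e \<bullet> \<alpha>) \<in> \<int>" by (simp add: inner_add_left)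
        then obtain k where "t * (e \<bullet> \<alpha>) = real_of_int k" by (rule Ints_cases)
        then show False using t by simp
      qed
    qed
  qed
  ultimately have "\<forall>\<^sub>F t in at_right 0. (\<forall>\<beta>\<in>A. (p + t *\<^sub>R e) \<bullet> \<beta> \<notin> \<int>) \<and> (p + t *\<^sub>R e) \<bullet> \<alpha> \<notin> \<int>"
    by (rule eventually_conj)
  then obtain t where "(\<forall>\<beta>\<in>A. (p + t *\<^sub>R e) \<bullet> \<beta> \<notin> \<int>) \<and> (p + t *\<^sub>R e) \<bullet> \<alpha> \<notin> \<int>"
    using eventually_happens'[OF trivial_limit_at_right_real] by blast
  then show ?case using aval by (intro exI[of _ "p + t *\<^sub>R e"]) simp
qed

text \<open>
  If the hyperplane of an affine root contains \<open>p\<close>, its linear part takes an integral value at \<open>p\<close>. So it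
  suffices to move inside the common zero set of \<open>B\<close> until no linear part that is nonconstant on this set
  has an integral value.
\<close>

lemma generic_common_zero:
  assumes B: "\<And>y. y \<in> B \<Longrightarrow> aval y p0 = 0"
  obtains p where "\<And>y. y \<in> B \<Longrightarrow> aval y p = 0" "\<And>x. x \<in> affine_roots \<Longrightarrow> aval x p = 0 \<Longrightarrow> x \<in> span B"
proof -
  obtain p where p: "\<forall>y\<in>B. aval y p = 0" "\<forall>\<alpha>\<in>\<Phi> - span (fst ` B). p \<bullet> \<alpha> \<notin> \<int>"
    using non_integral_point[of "\<Phi> - span (fst ` B)" B p0] finite_roots B by auto
  have "x \<in> span B" if x: "x \<in> affine_roots" "aval x p = 0" for x
  proof -
    let ?L = "\<lambda>u::'a. (u, p \<bullet> u)"
    have lin: "linear ?L" by (rule linearI) (auto simp: inner_add_right)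
    have L: "?L (fst y) = y" if "aval y p = 0" for y using that by (simp add: aval_def prod_eq_iff)
    obtain \<alpha> k where xk: "x = (\<alpha>, real_of_int k)" "\<alpha> \<in> \<Phi>" using x(1) by (rule affine_rootE)
    have "p \<bullet> \<alpha> \<in> \<int>" using x(2) by (simp add: aval_def xk)
    then have "fst x \<in> span (fst ` B)" using p(2) xk by auto
    then have "?L (fst x) \<in> span (?L ` fst ` B)" by (simp add: linear_span_image[OF lin])
    moreover have "?L ` fst ` B = B" using p(1) L by (force simp: image_image)
    ultimately show ?thesis using L[OF x(2)] by simp
  qed
  with p(1) show thesis using that by blast
qed

text \<open>
  The roots vanishing at a generic common zero of \<open>B\<close> form \<open>root_orbit B\<close>, by integrality of coefficients.
  Moving this point into the closed alcove turns them into the roots of a standard parabolic subgroup.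
\<close>

lemma subword_generates_parabolic:
  assumes Z: "Z \<subseteq> affine_roots" "finite Z" "independent Z" "affine_roots \<subseteq> zspan Z" "acoroot ` affine_roots \<subseteq> zspan (acoroot ` Z)"
    and B: "B \<subseteq> Z" "\<And>y. y \<in> B \<Longrightarrow> aval y p0 = 0"
  obtains us J where "set us \<subseteq> simple_roots" "J \<subset> simple_roots" "card J = card B"
    "word_act us ` J \<subseteq> root_orbit B" "B \<subseteq> root_orbit (word_act us ` J)"
proof -
  have finB: "finite B" using B(1) Z(2) finite_subset by blast
  have indB: "independent B" using B(1) Z(3) independent_mono by blast
  have BRt: "B \<subseteq> affine_roots" using B(1) Z(1) by blast
  obtain p where p: "\<And>y. y \<in> B \<Longrightarrow> aval y p = 0" "\<And>x. x \<in> affine_roots \<Longrightarrow> aval x p = 0 \<Longrightarrow> x \<in> span B"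
    by (rule generic_common_zero[of B p0]) (use B(2) in blast)+
  have orbB: "x \<in> root_orbit B" if x: "x \<in> affine_roots" "aval x p = 0" for x
  proof -
    obtain n :: "'a \<times> real \<Rightarrow> int" where n: "x = (\<Sum>y\<in>Z. of_int (n y) *\<^sub>R y)"
      using Z(4) x(1) by (auto simp: zspan_def)
    obtain b where b: "x = (\<Sum>y\<in>B. b y *\<^sub>R y)" using p(2)[OF x] span_finite[OF finB] by auto
    have "(\<Sum>y\<in>B. b y *\<^sub>R y) = (\<Sum>y\<in>Z. (if y \<in> B then b y else 0) *\<^sub>R y)"
      by (rule sum.mono_neutral_cong_left) (use Z(2) B(1) in auto)
    with b n have nb: "(\<Sum>y\<in>Z. of_int (n y) *\<^sub>R y) = (\<Sum>y\<in>Z. (if y \<in> B then b y else 0) *\<^sub>R y)" by simp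
    have n0: "n y = 0" if "y \<in> Z - B" for y
      using independent_coeffs[OF Z(3,2) nb, of y] that by simp
    have nB: "x = (\<Sum>y\<in>B. of_int (n y) *\<^sub>R y)"
      unfolding n by (rule sum.mono_neutral_right) (use Z(2) B(1) n0 in auto)
    have "acoroot x \<in> zspan (acoroot ` Z)" using Z(5) x(1) by blast
    then obtain m :: "'a \<times> real \<Rightarrow> int" where m: "acoroot x = (\<Sum>y\<in>acoroot ` Z. of_int (m y) *\<^sub>R y)"
      by (auto simp: zspan_def)
    have "(\<Sum>y\<in>Z. (c * of_int (n y)) *\<^sub>R y) = c *\<^sub>R x" for c
      by (subst n) (simp add: scaleR_sum_right)
    then have "(\<Sum>y\<in>Z. (2 / (fst x \<bullet> fst x) * of_int (n y)) *\<^sub>R y) = acoroot x"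
      by (simp only: acoroot_def)
    also have "\<dots> = (\<Sum>y\<in>Z. (of_int (m (acoroot y)) * (2 / (fst y \<bullet> fst y))) *\<^sub>R y)"
      unfolding m sum.reindex[OF inj_on_acoroot[OF anisotropic_sub[OF Z(1)]]] by (simp add: acoroot_def)
    finally have eq: "(\<Sum>y\<in>Z. (2 / (fst x \<bullet> fst x) * of_int (n y)) *\<^sub>R y) =
      (\<Sum>y\<in>Z. (of_int (m (acoroot y)) * (2 / (fst y \<bullet> fst y))) *\<^sub>R y)" .
    have nm: "2 / (fst x \<bullet> fst x) * of_int (n y) = of_int (m (acoroot y)) * (2 / (fst y \<bullet> fst y))" if "y \<in> Z" for y
      by (rule independent_coeffs[OF Z(3,2) eq that])
    show ?thesis
    proof (rule in_orbit_if_integral[OF BRt finB p(1) x(1) nB])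
      fix y assume "y \<in> B"
      then have y: "y \<in> Z" using B(1) by auto
      have "fst y \<noteq> 0" using fst_R[of y] y Z(1) by auto
      moreover have "fst x \<noteq> 0" using fst_R x(1) by blast
      ultimately have "of_int (n y) * (fst y \<bullet> fst y) / (fst x \<bullet> fst x) = real_of_int (m (acoroot y))"
        using nm[OF y] by (simp add: field_simps)
      then show "of_int (n y) * (fst y \<bullet> fst y) / (fst x \<bullet> fst x) \<in> \<int>" by simp
    qed
  qed
  obtain vs where vs: "set vs \<subseteq> simple_roots" "\<And>s. s \<in> simple_roots \<Longrightarrow> aval s (word_map vs p) \<ge> 0"
    using orbit_meets_closed_alcove[of p] by metis
  have vsR: "set vs \<subseteq> affine_roots" using vs(1) simple_roots_affine_roots by blast
  have an: "anisotropic (set vs)" "anisotropic (set (rev vs))" using vsR by (auto intro: anisotropic_sub)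
  define q where "q = word_map vs p"
  define J where "J = {s \<in> simple_roots. aval s q = 0}"
  have orbJ: "x \<in> root_orbit J" if "x \<in> affine_roots" "aval x q = 0" for x
    using stabilizer_roots[of q] vs(2) that unfolding q_def J_def by blast
  let ?us = "rev vs"
  have pq: "word_map ?us q = p" unfolding q_def by (rule word_map_rev[OF an(1)])
  have JB: "word_act ?us ` J \<subseteq> root_orbit B"
  proof (rule image_subsetI)
    fix s assume s: "s \<in> J"
    have "word_act ?us s \<in> affine_roots" using s simple_roots_affine_roots vsR by (intro word_act_R) (auto simp: J_def)
    moreover have "aval (word_act ?us s) p = 0" using aval_word_act[OF an(2), of s q] s by (simp add: pq J_def)
    ultimately show "word_act ?us s \<in> root_orbit B" by (rule orbB)
  qed
  have BJ: "B \<subseteq> root_orbit (word_act ?us ` J)"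
  proof (rule subsetI)
    fix y assume y: "y \<in> B"
    let ?z = "word_act vs y"
    have "?z \<in> affine_roots" using y BRt vsR by (intro word_act_R) auto
    moreover have "aval ?z q = 0" using aval_word_act[OF an(1), of y p] p(1)[OF y] by (simp add: q_def)
    ultimately have "?z \<in> root_orbit J" by (rule orbJ)
    then obtain ys s where ys: "set ys \<subseteq> J" "s \<in> J" "?z = word_act ys s" unfolding root_orbit_def by blast
    have "y = word_act ?us (word_act ys s)" using word_act_rev[OF an(1), of y] ys(3) by simp
    also have "\<dots> = word_act (map (word_act ?us) ys) (word_act ?us s)" by (rule word_act_conj[OF an(2), symmetric])
    also have "\<dots> \<in> root_orbit (word_act ?us ` J)" using ys(1,2) by (intro root_orbitI) auto
    finally show "y \<in> root_orbit (word_act ?us ` J)" .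
  qed
  have JSm: "J \<subseteq> simple_roots" by (auto simp: J_def)
  have "J \<noteq> simple_roots"
  proof
    assume "J = simple_roots"
    then have J0: "\<forall>s\<in>simple_roots. aval s q = 0" by (auto simp: J_def)
    have "aval x q = 0" if "x \<in> span simple_roots" for x
      using that
    proof (induction rule: span_induct_alt)
      case (step c s y) then show ?case using J0 by (simp add: aval_add aval_scaleR)
    qed (simp add: aval_zero)
    then have "aval (0, 1) q = 0" using span_simple_roots by auto
    then show False by (simp add: aval_def)
  qed
  have inj: "inj (word_act ?us)" by (rule inj_on_inverseI[of _ "word_act vs"]) (use word_act_rev'[OF an(1)] in simp)
  have "independent J" using independent_simple_roots JSm independent_mono by blast
  then have indJ: "independent (word_act ?us ` J)"
    by (rule linear_independent_injective_image[OF linear_word_act]) (use inj in \<open>auto intro: inj_on_subset\<close>)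
  have "span (word_act ?us ` J) = span B"
  proof
    show "span (word_act ?us ` J) \<subseteq> span B" using JB root_orbit_subset_span by (intro span_minimal) auto
    show "span B \<subseteq> span (word_act ?us ` J)" using BJ root_orbit_subset_span by (intro span_minimal) auto
  qed
  then have "card (word_act ?us ` J) = card B" using indJ indB by (metis dim_eq_card_independent dim_span)
  moreover have "card (word_act ?us ` J) = card J" by (rule card_image) (use inj in \<open>auto intro: inj_on_subset\<close>)
  ultimately show thesis
    using that[of ?us J] vs(1) JSm \<open>J \<noteq> simple_roots\<close> JB BJ by auto
qed

lemma generating_words:
  assumes zs: "set zs \<subseteq> affine_roots" and gen: "\<And>x. x \<in> affine_roots \<Longrightarrow> arefl x \<in> generated_maps (set zs)"
  shows "affine_roots \<subseteq> zspan (set zs)" "acoroot ` affine_roots \<subseteq> zspan (acoroot ` set zs)" "span (set zs) = UNIV"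
proof -
  obtain a where a: "a \<in> alcove" by (rule alcove_nonempty)
  have root_orbit: "affine_roots \<subseteq> root_orbit (set zs)"
    by (rule R_subset_orbit_if_generating[OF zs gen]) (use a root_nonzero_on_alcove in auto)
  then show z: "affine_roots \<subseteq> zspan (set zs)" "acoroot ` affine_roots \<subseteq> zspan (acoroot ` set zs)"
    using root_orbit_subset_zspan[OF zs] by auto
  have "span simple_roots \<subseteq> span (set zs)"
    using simple_roots_affine_roots z(1) zspan_subset_span by (intro span_minimal) blast+
  then show "span (set zs) = UNIV" using span_simple_roots by auto
qed

lemma basis_word:
  fixes zs :: "('a \<times> real) list"
  assumes "span (set zs) = UNIV"
  shows "card simple_roots \<le> length zs" "length zs = card simple_roots \<Longrightarrow> distinct zs \<and> independent (set zs)"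
proof -
  have "dim (set zs) = DIM('a \<times> real)" using assms by (metis dim_eq_full)
  then have d: "card simple_roots = dim (set zs)" using card_simple_roots by simp
  have dim: "dim (set zs) \<le> card (set zs)" by (rule dim_le_card) (auto simp: span_superset)
  have len: "card (set zs) \<le> length zs" by (rule card_length)
  show "card simple_roots \<le> length zs" using d dim len by simp
  assume "length zs = card simple_roots"
  then have eq: "card (set zs) = length zs" "card (set zs) = dim (set zs)" using d dim len by auto
  have "independent (set zs)"
    by (rule card_le_dim_spanning[of _ UNIV]) (use assms eq d card_simple_roots in \<open>auto simp: dim_UNIV\<close>)
  then show "distinct zs \<and> independent (set zs)" using eq(1) card_distinct by blast
qed

end

section \<open>Reflection groups as monoid records\<close>

text \<open>
  Comparing \<open>v - arefl x v\<close> with \<open>v - arefl y v\<close> shows that the two affine functions are proportional.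
\<close>

lemma parallel_if_arefl_eq:
  assumes "fst x \<noteq> 0" "fst y \<noteq> 0" "arefl x = arefl y"
  obtains c where "y = c *\<^sub>R x"
proof -
  have eq: "aval x v *\<^sub>R fst (acoroot x) = aval y v *\<^sub>R fst (acoroot y)" for v
    using fun_cong[OF assms(3), of v] by (simp add: arefl_def)
  have cy: "fst (acoroot y) \<bullet> fst (acoroot y) \<noteq> 0" using assms(2) by (simp add: acoroot_def)
  let ?c = "(fst (acoroot x) \<bullet> fst (acoroot y)) / (fst (acoroot y) \<bullet> fst (acoroot y))"
  have "aval x v * (fst (acoroot x) \<bullet> fst (acoroot y)) = aval y v * (fst (acoroot y) \<bullet> fst (acoroot y))" for v
    using arg_cong[OF eq[of v], of "\<lambda>u. u \<bullet> fst (acoroot y)"] by simp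
  then have "aval y v = aval (?c *\<^sub>R x) v" for v using cy by (simp add: aval_scaleR field_simps)
  then have "y = ?c *\<^sub>R x" by (intro aval_inject ext)
  then show thesis by (rule that)
qed

lemma inj_on_arefl:
  assumes "anisotropic A" "independent A" shows "inj_on arefl A"
proof (rule inj_onI)
  fix x y assume xy: "x \<in> A" "y \<in> A" "arefl x = arefl y"
  then obtain c where c: "y = c *\<^sub>R x" using parallel_if_arefl_eq[of x y] assms(1) by (metis anisotropicD)
  show "x = y"
  proof (rule ccontr)
    assume "x \<noteq> y"
    then have "y \<in> span (A - {y})" using c xy(1) by (auto intro: span_scale span_base)
    then show False using assms(2) xy(2) by (auto simp: dependent_def)
  qed
qed

abbreviation maps :: "('a::euclidean_space \<Rightarrow> 'a) monoid" where
  "maps \<equiv> BijGroup UNIV"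

definition reflection_group :: "('a::euclidean_space \<times> real) set \<Rightarrow> ('a \<Rightarrow> 'a) monoid" where
  "reflection_group Y = maps\<lparr>carrier := generated_maps Y\<rparr>"

lemma carrier_reflection_group: "carrier (reflection_group Y) = generated_maps Y" by (simp add: reflection_group_def)

lemma maps_mult: "bij f \<Longrightarrow> bij g \<Longrightarrow> f \<otimes>\<^bsub>maps\<^esub> g = f \<circ> g"
  by (simp add: BijGroup_def Bij_def compose_def fun_eq_iff)

lemma maps_one: "\<one>\<^bsub>maps\<^esub> = id"
  by (simp add: BijGroup_def fun_eq_iff)

lemma carrier_maps: "carrier maps = {f. bij f}"
  by (auto simp: BijGroup_def Bij_def)

lemma bij_word_map: assumes "anisotropic (set ys)" shows "bij (word_map ys)"
  by (rule bij_betw_byWitness[of _ "word_map (rev ys)"]) (use word_map_rev[OF assms] word_map_rev'[OF assms] in auto)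

lemma bij_generated_maps: assumes "anisotropic Y" "f \<in> generated_maps Y" shows "bij f"
proof -
  obtain ys where "set ys \<subseteq> Y" "f = word_map ys" using assms(2) by (auto simp: generated_maps_def)
  then show ?thesis using bij_word_map anisotropic_subset[OF assms(1)] by blast
qed

lemma maps_inv: assumes "anisotropic (set ys)" shows "inv\<^bsub>maps\<^esub> (word_map ys) = word_map (rev ys)"
proof (rule group.inv_equality[OF group_BijGroup])
  have "word_map (rev ys) \<circ> word_map ys = id" using word_map_rev[OF assms] by (simp add: fun_eq_iff)
  then show "word_map (rev ys) \<otimes>\<^bsub>maps\<^esub> word_map ys = \<one>\<^bsub>maps\<^esub>"
    using assms by (simp add: maps_mult maps_one bij_word_map)
qed (use assms in \<open>auto simp: carrier_maps bij_word_map\<close>)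

lemma subgroup_generated_maps: assumes "anisotropic Y" shows "subgroup (generated_maps Y) maps"
proof (rule subgroup.intro)
  show "generated_maps Y \<subseteq> carrier maps" using bij_generated_maps[OF assms] by (auto simp: carrier_maps)
  show "f \<otimes>\<^bsub>maps\<^esub> g \<in> generated_maps Y" if "f \<in> generated_maps Y" "g \<in> generated_maps Y" for f g
    using that bij_generated_maps[OF assms] by (simp add: maps_mult generated_maps_comp)
  show "\<one>\<^bsub>maps\<^esub> \<in> generated_maps Y" by (simp add: maps_one generated_maps_id)
  show "inv\<^bsub>maps\<^esub> f \<in> generated_maps Y" if f: "f \<in> generated_maps Y" for f
  proof -
    obtain ys where ys: "set ys \<subseteq> Y" "f = word_map ys" using f by (auto simp: generated_maps_def)
    then have "inv\<^bsub>maps\<^esub> f = word_map (rev ys)" using maps_inv anisotropic_subset[OF assms] by blast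
    then show ?thesis using generated_maps_word_map[of "rev ys" Y] ys by simp
  qed
qed

lemma reflection_group_mult: "anisotropic Y \<Longrightarrow> f \<in> generated_maps Y \<Longrightarrow> g \<in> generated_maps Y \<Longrightarrow> f \<otimes>\<^bsub>reflection_group Y\<^esub> g = f \<circ> g"
  using bij_generated_maps[of Y f] bij_generated_maps[of Y g] by (simp add: reflection_group_def maps_mult)

lemma reflection_group_one: "\<one>\<^bsub>reflection_group Y\<^esub> = id"
  by (simp add: reflection_group_def maps_one)

lemma reflection_group_inv:
  assumes "anisotropic Y" "set ys \<subseteq> Y" shows "inv\<^bsub>reflection_group Y\<^esub> (word_map ys) = word_map (rev ys)"
  unfolding reflection_group_def
  using group.m_inv_consistent[OF group_BijGroup subgroup_generated_maps[OF assms(1)] generated_maps_word_map[OF assms(2)]]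
    maps_inv[OF anisotropic_subset[OF assms]] by simp

lemma generate_maps: assumes "anisotropic Z" shows "generate maps (arefl ` Z) = generated_maps Z"
proof
  show "generate maps (arefl ` Z) \<subseteq> generated_maps Z"
  proof
    fix f assume "f \<in> generate maps (arefl ` Z)"
    then show "f \<in> generated_maps Z"
    proof (induction rule: generate.induct)
      case one show ?case unfolding maps_one by (rule generated_maps_id)
    next
      case (incl h) then show ?case using generated_maps_word_map[of "[_]" Z] by auto
    next
      case (inv h)
      then obtain z where z: "z \<in> Z" "h = word_map [z]" by auto
      then have "inv\<^bsub>maps\<^esub> h = word_map [z]" using maps_inv[of "[z]"] assms by (simp add: anisotropic_def)
      then show ?case using z generated_maps_word_map[of "[z]" Z] by simp
    next
      case (eng f g)
      then have "f \<otimes>\<^bsub>maps\<^esub> g = f \<circ> g" using bij_generated_maps[OF assms] by (intro maps_mult) auto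
      then show ?case using eng.IH generated_maps_comp by metis
    qed
  qed
  have "word_map zs \<in> generate maps (arefl ` Z)" if "set zs \<subseteq> Z" for zs
    using that
  proof (induction zs)
    case Nil
    have "\<one>\<^bsub>maps\<^esub> \<in> generate maps (arefl ` Z)" by (rule generate.one)
    then show ?case by (simp only: maps_one word_map.simps)
  next
    case (Cons z zs)
    have "bij (arefl z)" "bij (word_map zs)"
      using bij_word_map[of "[z]"] bij_word_map[of zs] anisotropic_subset[OF assms Cons.prems] by (auto simp: anisotropic_def)
    then have "word_map (z # zs) = arefl z \<otimes>\<^bsub>maps\<^esub> word_map zs" by (simp add: maps_mult)
    then show ?case using Cons by (auto intro: generate.intros)
  qed
  then show "generated_maps Z \<subseteq> generate maps (arefl ` Z)" by (auto simp: generated_maps_def)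
qed

lemma generate_reflection_group:
  assumes "anisotropic Y" "anisotropic Z" "arefl ` Z \<subseteq> generated_maps Y"
  shows "generate (reflection_group Y) (arefl ` Z) = generated_maps Z"
  unfolding reflection_group_def generate_maps[OF assms(2), symmetric]
  using group.generate_consistent[OF group_BijGroup assms(3) subgroup_generated_maps[OF assms(1)]] by simp

lemma arefl_in_generated_maps: "y \<in> Y \<Longrightarrow> arefl y \<in> generated_maps Y"
  using generated_maps_word_map[of "[y]" Y] by simp

lemma conj_set_reflection_group:
  assumes "anisotropic Y" "set us \<subseteq> Y" "A \<subseteq> generated_maps Y"
  shows "conj_set (reflection_group Y) (word_map us) A = (\<lambda>f. word_map us \<circ> f \<circ> word_map (rev us)) ` A"
proof -
  have u: "word_map us \<in> generated_maps Y" "word_map (rev us) \<in> generated_maps Y" using assms(2) by (auto intro!: generated_maps_word_map)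
  have "word_map us \<otimes>\<^bsub>reflection_group Y\<^esub> f \<otimes>\<^bsub>reflection_group Y\<^esub> word_map (rev us) = word_map us \<circ> f \<circ> word_map (rev us)" if "f \<in> A" for f
    using that assms u by (simp add: reflection_group_mult generated_maps_comp subset_iff)
  then show ?thesis
    by (auto simp: conj_set_def r_coset_def l_coset_def reflection_group_inv[OF assms(1,2)])
qed

lemma generated_maps_conj:
  assumes "anisotropic (set us)"
  shows "generated_maps (word_act us ` I) = (\<lambda>f. word_map us \<circ> f \<circ> word_map (rev us)) ` generated_maps I"
proof -
  have "{zs. set zs \<subseteq> word_act us ` I} = map (word_act us) ` {ys. set ys \<subseteq> I}"
    by (simp add: lists_image[unfolded lists_eq_set])
  then have "generated_maps (word_act us ` I) = word_map ` map (word_act us) ` {ys. set ys \<subseteq> I}"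
    unfolding generated_maps_def by blast
  also have "\<dots> = (\<lambda>f. word_map us \<circ> f \<circ> word_map (rev us)) ` word_map ` {ys. set ys \<subseteq> I}"
    by (simp add: image_image word_map_conj[OF assms])
  also have "word_map ` {ys. set ys \<subseteq> I} = generated_maps I" unfolding generated_maps_def by blast
  finally show ?thesis .
qed

lemma reflections_reflection_group:
  assumes "anisotropic Y" shows "reflections (reflection_group Y) (arefl ` Y) = arefl ` root_orbit Y"
proof -
  have *: "word_map ys \<otimes>\<^bsub>reflection_group Y\<^esub> arefl y \<otimes>\<^bsub>reflection_group Y\<^esub> inv\<^bsub>reflection_group Y\<^esub> word_map ys = arefl (word_act ys y)"
    if "set ys \<subseteq> Y" "y \<in> Y" for ys y
    using that generated_maps_word_map[of ys Y] generated_maps_word_map[of "rev ys" Y] arefl_in_generated_maps[of y Y]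
    by (simp add: reflection_group_inv assms reflection_group_mult generated_maps_comp arefl_word_act[OF anisotropic_subset[OF assms]])
  show ?thesis
  proof (intro equalityI subsetI)
    fix t assume "t \<in> reflections (reflection_group Y) (arefl ` Y)"
    then obtain ys y where "set ys \<subseteq> Y" "y \<in> Y"
      "t = word_map ys \<otimes>\<^bsub>reflection_group Y\<^esub> arefl y \<otimes>\<^bsub>reflection_group Y\<^esub> inv\<^bsub>reflection_group Y\<^esub> word_map ys"
      unfolding reflections_def carrier_reflection_group generated_maps_def by blast
    then show "t \<in> arefl ` root_orbit Y" using * root_orbitI by blast
  next
    fix t assume "t \<in> arefl ` root_orbit Y"
    then obtain ys y where "set ys \<subseteq> Y" "y \<in> Y" "t = arefl (word_act ys y)" unfolding root_orbit_def by blast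
    then show "t \<in> reflections (reflection_group Y) (arefl ` Y)"
      unfolding reflections_def carrier_reflection_group using * generated_maps_word_map by (metis (mono_tags, lifting) imageI mem_Collect_eq)
  qed
qed

lemma foldr_reflection_group:
  assumes "anisotropic Y" "set zs \<subseteq> root_orbit Y"
  shows "foldr (\<otimes>\<^bsub>reflection_group Y\<^esub>) (map arefl zs) \<one>\<^bsub>reflection_group Y\<^esub> = word_map zs \<and> word_map zs \<in> generated_maps Y"
  using assms(2)
  by (induction zs) (auto simp: reflection_group_one generated_maps_id reflection_group_mult[OF assms(1)] arefl_root_orbit_in_generated_maps[OF assms(1)] generated_maps_comp)

lemma reflection_factorization_reflection_group:
  assumes "anisotropic Y"
  shows "reflection_factorization (reflection_group Y) (arefl ` Y) x ts \<longleftrightarrow>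
    (\<exists>zs. set zs \<subseteq> root_orbit Y \<and> ts = map arefl zs \<and> word_map zs = x)"
proof
  assume f: "reflection_factorization (reflection_group Y) (arefl ` Y) x ts"
  then have "set ts \<subseteq> arefl ` root_orbit Y" by (simp add: reflection_factorization_def reflections_reflection_group assms)
  then have "ts \<in> lists (arefl ` root_orbit Y)" by (auto simp: lists_eq_set)
  then obtain zs where "set zs \<subseteq> root_orbit Y" "ts = map arefl zs" unfolding lists_image by (auto simp: lists_eq_set)
  then show "\<exists>zs. set zs \<subseteq> root_orbit Y \<and> ts = map arefl zs \<and> word_map zs = x"
    using f foldr_reflection_group[OF assms, of zs] by (auto simp: reflection_factorization_def)
next
  assume "\<exists>zs. set zs \<subseteq> root_orbit Y \<and> ts = map arefl zs \<and> word_map zs = x"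
  then show "reflection_factorization (reflection_group Y) (arefl ` Y) x ts"
    unfolding reflection_factorization_def reflections_reflection_group[OF assms] using foldr_reflection_group[OF assms] by force
qed

definition refl_length :: "('a::euclidean_space \<times> real) set \<Rightarrow> ('a \<Rightarrow> 'a) \<Rightarrow> nat" where
  "refl_length Y x = (LEAST m. \<exists>zs. set zs \<subseteq> root_orbit Y \<and> word_map zs = x \<and> length zs = m)"

lemma reflection_length_reflection_group:
  assumes "anisotropic Y"
  shows "reflection_length (reflection_group Y) (arefl ` Y) x = refl_length Y x"
  unfolding reflection_length_def refl_length_def
  reflection_factorization_reflection_group[OF assms] by (metis length_map)

lemma refl_length_le: "set zs \<subseteq> root_orbit Y \<Longrightarrow> word_map zs = x \<Longrightarrow> refl_length Y x \<le> length zs"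
  unfolding refl_length_def by (rule Least_le) blast

lemma refl_length_word:
  assumes "x \<in> generated_maps Y" obtains zs where "set zs \<subseteq> root_orbit Y" "word_map zs = x" "length zs = refl_length Y x"
proof -
  obtain ys where "set ys \<subseteq> Y" "x = word_map ys" using assms by (auto simp: generated_maps_def)
  then have "\<exists>m zs. set zs \<subseteq> root_orbit Y \<and> word_map zs = x \<and> length zs = m" using root_orbit_base by blast
  from LeastI_ex[OF this] show thesis using that unfolding refl_length_def by blast
qed

lemma quasi_Coxeter_reflection_group:
  assumes "anisotropic Y"
  shows "quasi_Coxeter (reflection_group Y) (arefl ` Y) x \<longleftrightarrow>
    (\<exists>zs. set zs \<subseteq> root_orbit Y \<and> word_map zs = x \<and> length zs = refl_length Y x \<and> length zs = card (arefl ` Y) \<and> generated_maps (set zs) = generated_maps Y)"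
proof -
  have anorb: "anisotropic (root_orbit Y)"
    unfolding anisotropic_def
  proof
    fix x assume "x \<in> root_orbit Y"
    then obtain ys y where x: "set ys \<subseteq> Y" "y \<in> Y" "x = word_act ys y" unfolding root_orbit_def by blast
    then have "fst x \<bullet> fst x = fst y \<bullet> fst y"
      using word_act_inner[OF anisotropic_subset[OF assms x(1)]] by simp
    then show "fst x \<noteq> 0" using anisotropicD[OF assms x(2)] by auto
  qed
  have gen: "generate (reflection_group Y) (set (map arefl zs)) = generated_maps (set zs)" if "set zs \<subseteq> root_orbit Y" for zs
  proof -
    have "arefl ` set zs \<subseteq> generated_maps Y" using that arefl_root_orbit_in_generated_maps[OF assms] by blast
    from generate_reflection_group[OF assms anisotropic_subset[OF anorb that] this] show ?thesis by simp
  qed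
  show ?thesis
    unfolding quasi_Coxeter_def reduced_reflection_factorization_def carrier_reflection_group
      reflection_factorization_reflection_group[OF assms] reflection_length_reflection_group[OF assms]
    using gen foldr_reflection_group[OF assms] by (metis length_map)
qed

lemma pow_reflection_group:
  assumes "anisotropic Y" "x \<in> generated_maps Y" shows "x [^]\<^bsub>reflection_group Y\<^esub> (n::nat) = x ^^ n \<and> x ^^ n \<in> generated_maps Y"
proof (induction n)
  case 0
  show ?case unfolding funpow_0 using generated_maps_id[of Y] by (simp add: reflection_group_one nat_pow_def id_def)
next
  case (Suc n)
  have "x [^]\<^bsub>reflection_group Y\<^esub> Suc n = x [^]\<^bsub>reflection_group Y\<^esub> n \<otimes>\<^bsub>reflection_group Y\<^esub> x" by (simp add: nat_pow_def)
  also have "\<dots> = x ^^ n \<circ> x" using Suc assms(2) by (simp only: reflection_group_mult[OF assms(1)])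
  finally show ?case unfolding funpow_Suc_right using generated_maps_comp Suc assms(2) by metis
qed

section \<open>Parabolic quasi-Coxeter elements\<close>

context affine_coxeter
begin

lemma anisotropic_simple_roots: "anisotropic simple_roots" using simple_roots_affine_roots by (rule anisotropic_sub)

lemma root_orbit_simple_roots: "root_orbit simple_roots = affine_roots"
  using affine_roots_orbit_simple_roots root_orbit_R[OF simple_roots_affine_roots] by blast

lemma generated_maps_affine_roots: "generated_maps affine_roots = generated_maps simple_roots"
  using generated_maps_root_orbit[OF anisotropic_simple_roots] by (simp add: root_orbit_simple_roots)

lemma affine_Weyl_group_eq: "affine_Weyl_group \<Phi> = reflection_group simple_roots"
proof -
  have "{affine_reflection \<alpha> k | \<alpha> k. \<alpha> \<in> \<Phi>} = arefl ` affine_roots"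
    by (auto simp: affine_roots_def affine_reflection_eq_refl)
  then show ?thesis
    using generate_maps[OF anisotropic_R] by (simp add: affine_Weyl_group_def reflection_group_def generated_maps_affine_roots)
qed

lemma affine_simple_reflections_eq: "affine_simple_reflections \<Delta> \<theta> = arefl ` simple_roots"
proof -
  have "affine_reflection \<theta> 1 = arefl (- \<theta>, - 1)"
    using arefl_scaleR[of "- 1" "(\<theta>, 1)"] by (simp add: affine_reflection_eq_refl)
  then show ?thesis
    by (auto simp: affine_simple_reflections_def simple_roots_def affine_reflection_eq_refl)
qed

lemma card_conj_simple:
  assumes "set us \<subseteq> simple_roots" "J \<subseteq> simple_roots"
  shows "card (arefl ` word_act us ` J) = card J"
proof -
  have an: "anisotropic (set us)" using assms(1) simple_roots_affine_roots by (intro anisotropic_sub) auto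
  have inj: "inj (word_act us)" by (rule inj_on_inverseI[of _ "word_act (rev us)"]) (simp add: word_act_rev[OF an])
  have "independent J" using independent_simple_roots assms(2) independent_mono by blast
  then have "independent (word_act us ` J)"
    by (rule linear_independent_injective_image[OF linear_word_act]) (rule inj_on_subset[OF inj subset_UNIV])
  moreover have "anisotropic (word_act us ` J)"
    using assms simple_roots_affine_roots by (intro anisotropic_sub image_subsetI word_act_R) auto
  ultimately have "card (arefl ` word_act us ` J) = card (word_act us ` J)" by (intro card_image inj_on_arefl)
  also have "\<dots> = card J" by (rule card_image) (rule inj_on_subset[OF inj subset_UNIV])
  finally show ?thesis .
qed

lemma parabolic_eq:
  assumes "set us \<subseteq> simple_roots" "J \<subseteq> simple_roots"
  shows "conj_set (reflection_group simple_roots) (word_map us) (generate (reflection_group simple_roots) (arefl ` J)) = generated_maps (word_act us ` J)"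
    and "conj_set (reflection_group simple_roots) (word_map us) (arefl ` J) = arefl ` word_act us ` J"
    and "(reflection_group simple_roots)\<lparr>carrier := generated_maps (word_act us ` J)\<rparr> = reflection_group (word_act us ` J)"
proof -
  have an: "anisotropic (set us)" using anisotropic_subset[OF anisotropic_simple_roots assms(1)] .
  have J: "arefl ` J \<subseteq> generated_maps simple_roots" using assms(2) arefl_in_generated_maps by blast
  have g: "generate (reflection_group simple_roots) (arefl ` J) = generated_maps J"
    by (rule generate_reflection_group[OF anisotropic_simple_roots anisotropic_subset[OF anisotropic_simple_roots assms(2)] J])
  show "conj_set (reflection_group simple_roots) (word_map us) (generate (reflection_group simple_roots) (arefl ` J)) = generated_maps (word_act us ` J)"
    unfolding g conj_set_reflection_group[OF anisotropic_simple_roots assms(1) generated_maps_mono[OF assms(2)]] by (rule generated_maps_conj[OF an, symmetric])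
  show "conj_set (reflection_group simple_roots) (word_map us) (arefl ` J) = arefl ` word_act us ` J"
    unfolding conj_set_reflection_group[OF anisotropic_simple_roots assms(1) J] by (simp add: image_image arefl_word_act[OF an])
  show "(reflection_group simple_roots)\<lparr>carrier := generated_maps (word_act us ` J)\<rparr> = reflection_group (word_act us ` J)"
    by (simp add: reflection_group_def)
qed

lemma conj_simple_affine_roots: "set us \<subseteq> simple_roots \<Longrightarrow> J \<subseteq> simple_roots \<Longrightarrow> word_act us ` J \<subseteq> affine_roots"
  using simple_roots_affine_roots by (intro image_subsetI word_act_R) auto

lemma generated_maps_subset_W: "Y \<subseteq> affine_roots \<Longrightarrow> generated_maps Y \<subseteq> generated_maps simple_roots"
  using generated_maps_mono[of Y affine_roots] by (simp add: generated_maps_affine_roots)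

lemma conj_simple_roots_generates:
  assumes us: "set us \<subseteq> simple_roots" and x: "x \<in> affine_roots"
  shows "x \<in> root_orbit (word_act us ` simple_roots)"
proof -
  have an: "anisotropic (set us)" using anisotropic_subset[OF anisotropic_simple_roots us] .
  have "word_act (rev us) x \<in> affine_roots" using us simple_roots_affine_roots x by (intro word_act_R) auto
  then obtain vs s where vs: "set vs \<subseteq> simple_roots" "s \<in> simple_roots" "word_act (rev us) x = word_act vs s"
    unfolding root_orbit_simple_roots[symmetric] root_orbit_def by blast
  have "x = word_act us (word_act vs s)" using word_act_rev'[OF an, of x] vs(3) by simp
  also have "\<dots> = word_act (map (word_act us) vs) (word_act us s)" by (rule word_act_conj[OF an, symmetric])
  also have "\<dots> \<in> root_orbit (word_act us ` simple_roots)" using vs by (intro root_orbitI) auto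
  finally show ?thesis .
qed

lemma generated_maps_conj_simple_roots: assumes "set us \<subseteq> simple_roots" shows "generated_maps (word_act us ` simple_roots) = generated_maps simple_roots"
proof
  show "generated_maps (word_act us ` simple_roots) \<subseteq> generated_maps simple_roots" by (rule generated_maps_subset_W[OF conj_simple_affine_roots[OF assms order_refl]])
  have "generated_maps affine_roots \<subseteq> generated_maps (root_orbit (word_act us ` simple_roots))" using conj_simple_roots_generates[OF assms] by (intro generated_maps_mono) blast
  then show "generated_maps simple_roots \<subseteq> generated_maps (word_act us ` simple_roots)"
    using generated_maps_root_orbit[OF anisotropic_sub[OF conj_simple_affine_roots[OF assms order_refl]]] by (simp add: generated_maps_affine_roots)
qed

lemma generated_maps_fixes: assumes "\<And>y. y \<in> Y \<Longrightarrow> aval y p = 0" "f \<in> generated_maps Y" shows "f p = p"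
proof -
  have "word_map ys p = p" if "set ys \<subseteq> Y" for ys
    using that by (induction ys) (auto simp: arefl_def assms(1))
  then show ?thesis using assms(2) by (auto simp: generated_maps_def)
qed

lemma proper_parabolic_fixes_point:
  assumes us: "set us \<subseteq> simple_roots" and J: "J \<subset> simple_roots"
  shows "\<exists>p. \<forall>f\<in>generated_maps (word_act us ` J). f p = p"
proof -
  have an: "anisotropic (set us)" using anisotropic_subset[OF anisotropic_simple_roots us] .
  obtain q where q: "\<And>s. s \<in> J \<Longrightarrow> aval s q = 0" using proper_subset_fixes_point[OF J] by metis
  have "f (word_map us q) = word_map us q" if "f \<in> generated_maps (word_act us ` J)" for f
    by (rule generated_maps_fixes[OF _ that]) (auto simp: aval_word_act[OF an] q)
  then show ?thesis by blast
qed

lemma W_fixes_no_point: obtains f where "f \<in> generated_maps simple_roots" "f p \<noteq> p"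
proof -
  obtain x where x: "x \<in> affine_roots" "aval x p \<noteq> 0" by (rule no_common_zero)
  have "arefl x \<in> generated_maps simple_roots" using arefl_in_generated_maps[OF x(1)] by (simp add: generated_maps_affine_roots)
  moreover have "arefl x p \<noteq> p" using x fst_R arefl_eq_self_iff by blast
  ultimately show thesis by (rule that)
qed

lemma refl_length_basis_word:
  assumes "set ys \<subseteq> affine_roots" "span (set ys) = UNIV" "length ys = card simple_roots"
  shows "refl_length simple_roots (word_map ys) = card simple_roots"
proof (rule antisym)
  show "refl_length simple_roots (word_map ys) \<le> card simple_roots" using refl_length_le[of ys simple_roots] assms by (simp add: root_orbit_simple_roots)
  have "word_map ys \<in> generated_maps simple_roots" using assms(1) generated_maps_word_map[of ys affine_roots] by (simp add: generated_maps_affine_roots)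
  then obtain zs where zs: "set zs \<subseteq> affine_roots" "word_map zs = word_map ys" "length zs = refl_length simple_roots (word_map ys)"
    using refl_length_word[of "word_map ys" simple_roots] unfolding root_orbit_simple_roots by metis
  have "span (set zs) = UNIV"
    using independent_word_spans[OF anisotropic_sub[OF assms(1)] anisotropic_sub[OF zs(1)] zs(2)[symmetric]]
      basis_word(2)[OF assms(2,3)] assms(2) by blast
  then show "card simple_roots \<le> refl_length simple_roots (word_map ys)" using basis_word(1) zs(3) by metis
qed

lemma refl_length_triangle:
  assumes "x \<in> generated_maps simple_roots" "y \<in> generated_maps simple_roots" shows "refl_length simple_roots (x \<circ> y) \<le> refl_length simple_roots x + refl_length simple_roots y"
proof -
  obtain xs where xs: "set xs \<subseteq> root_orbit simple_roots" "word_map xs = x" "length xs = refl_length simple_roots x" using refl_length_word[OF assms(1)] .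
  obtain ys where ys: "set ys \<subseteq> root_orbit simple_roots" "word_map ys = y" "length ys = refl_length simple_roots y" using refl_length_word[OF assms(2)] .
  show ?thesis using refl_length_le[of "xs @ ys" simple_roots "x \<circ> y"] xs ys by (simp add: word_map_append)
qed

lemma absolute_le_reflection_group:
  assumes "set xs \<subseteq> affine_roots" 
  shows "absolute_le (reflection_group simple_roots) (arefl ` simple_roots) (word_map xs) w \<longleftrightarrow>
    refl_length simple_roots (word_map xs) + refl_length simple_roots (inv\<^bsub>reflection_group simple_roots\<^esub> (word_map xs) \<otimes>\<^bsub>reflection_group simple_roots\<^esub> w) = refl_length simple_roots w"
  unfolding absolute_le_def reflection_length_reflection_group[OF anisotropic_simple_roots] ..

lemma reflection_group_affine_roots: "reflection_group affine_roots = reflection_group simple_roots"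
  by (simp add: reflection_group_def generated_maps_affine_roots)

lemma inv_mult_W:
  assumes "set xs \<subseteq> affine_roots" "w \<in> generated_maps simple_roots"
  shows "inv\<^bsub>reflection_group simple_roots\<^esub> (word_map xs) \<otimes>\<^bsub>reflection_group simple_roots\<^esub> w = word_map (rev xs) \<circ> w"
  unfolding reflection_group_affine_roots[symmetric] reflection_group_inv[OF anisotropic_R assms(1)]
  using assms generated_maps_word_map[of "rev xs" affine_roots] by (intro reflection_group_mult[OF anisotropic_R]) (simp_all add: generated_maps_affine_roots)

text \<open>
  The conjugated simple reflections outside \<open>J\<close> complete a generating factorization of \<open>x\<close> to one of
  the whole group. Its length is the rank, hence it is reduced, and so are its initial and final parts.
\<close>

lemma parabolic_quasi_Coxeter_extends:
  assumes us: "set us \<subseteq> simple_roots" and J: "J \<subseteq> simple_roots"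
    and qc: "quasi_Coxeter (reflection_group (word_act us ` J)) (arefl ` word_act us ` J) x"
  obtains w where "quasi_Coxeter (reflection_group simple_roots) (arefl ` simple_roots) w" "absolute_le (reflection_group simple_roots) (arefl ` simple_roots) x w"
proof -
  let ?J = "word_act us ` J"
  have JR: "?J \<subseteq> affine_roots" by (rule conj_simple_affine_roots[OF us J])
  obtain zs where zs: "set zs \<subseteq> root_orbit ?J" "word_map zs = x" "length zs = card (arefl ` ?J)" "generated_maps (set zs) = generated_maps ?J"
    using qc unfolding quasi_Coxeter_reflection_group[OF anisotropic_sub[OF JR]] by blast
  have zsR: "set zs \<subseteq> affine_roots" using zs(1) root_orbit_R[OF JR] by blast
  obtain ss where ss: "set ss = simple_roots - J" "distinct ss" using finite_distinct_list[of "simple_roots - J"] finite_simple_roots by auto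
  let ?ss = "map (word_act us) ss"
  define ys where "ys = zs @ ?ss"
  have ssR: "set ?ss \<subseteq> affine_roots" using conj_simple_affine_roots[OF us, of "simple_roots - J"] ss(1) by auto
  then have ysR: "set ys \<subseteq> affine_roots" using zsR by (simp add: ys_def)
  have "length ss = card simple_roots - card J"
    using ss distinct_card[of ss] J finite_simple_roots by (simp add: card_Diff_subset finite_subset)
  then have len: "length ys = card simple_roots"
    using zs(3) card_conj_simple[OF us J] card_mono[OF finite_simple_roots J] by (simp add: ys_def)
  have "arefl z \<in> generated_maps (set ys)" if "z \<in> word_act us ` simple_roots" for z
  proof -
    have "z \<in> ?J \<or> z \<in> set ?ss" using that ss(1) by auto
    then show ?thesis
    proof
      assume "z \<in> ?J"
      then have "arefl z \<in> generated_maps (set zs)" unfolding zs(4) by (rule arefl_in_generated_maps)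
      then show ?thesis using generated_maps_mono[of "set zs" "set ys"] by (auto simp: ys_def)
    next
      assume "z \<in> set ?ss"
      then show ?thesis by (intro arefl_in_generated_maps) (simp add: ys_def)
    qed
  qed
  then have sub: "generated_maps simple_roots \<subseteq> generated_maps (set ys)" using generated_maps_closed[of "word_act us ` simple_roots" "set ys"] generated_maps_conj_simple_roots[OF us] by blast
  then have gen: "generated_maps (set ys) = generated_maps simple_roots" using generated_maps_subset_W[OF ysR] by blast
  have "arefl x \<in> generated_maps (set ys)" if "x \<in> affine_roots" for x
    using sub arefl_in_generated_maps[OF that] unfolding generated_maps_affine_roots by blast
  then have span: "span (set ys) = UNIV" by (rule generating_words(3)[OF ysR])
  have rl: "refl_length simple_roots (word_map ys) = card simple_roots" by (rule refl_length_basis_word[OF ysR span len])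
  have "card (arefl ` simple_roots) = card simple_roots" using card_conj_simple[of "[]" simple_roots] by simp
  then have "quasi_Coxeter (reflection_group simple_roots) (arefl ` simple_roots) (word_map ys)"
    unfolding quasi_Coxeter_reflection_group[OF anisotropic_simple_roots] root_orbit_simple_roots using ysR rl len gen by metis
  moreover have "absolute_le (reflection_group simple_roots) (arefl ` simple_roots) x (word_map ys)"
  proof -
    have w: "word_map ys \<in> generated_maps simple_roots" using generated_maps_word_map[OF ysR] by (simp add: generated_maps_affine_roots)
    have "word_map (rev zs) \<circ> word_map ys = word_map ?ss"
      using word_map_rev[OF anisotropic_sub[OF zsR]] by (simp add: ys_def word_map_append fun_eq_iff)
    then have i: "inv\<^bsub>reflection_group simple_roots\<^esub> x \<otimes>\<^bsub>reflection_group simple_roots\<^esub> word_map ys = word_map ?ss"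
      using inv_mult_W[OF zsR w] zs(2) by simp
    have "refl_length simple_roots x \<le> length zs" using refl_length_le[of zs simple_roots x] zsR zs(2) by (simp add: root_orbit_simple_roots)
    moreover have "refl_length simple_roots (word_map ?ss) \<le> length ss" using refl_length_le[of ?ss simple_roots] ssR by (simp add: root_orbit_simple_roots)
    moreover have "refl_length simple_roots (word_map ys) \<le> refl_length simple_roots x + refl_length simple_roots (word_map ?ss)"
      using refl_length_triangle[of x "word_map ?ss"] generated_maps_word_map[OF zsR] generated_maps_word_map[OF ssR] zs(2)
      by (simp add: ys_def word_map_append generated_maps_affine_roots)
    ultimately have "refl_length simple_roots x + refl_length simple_roots (word_map ?ss) = refl_length simple_roots (word_map ys)"
      using rl len by (simp add: ys_def)
    then show ?thesis using absolute_le_reflection_group[OF zsR] i zs(2) by metis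
  qed
  ultimately show thesis by (rule that)
qed

text \<open>
  The factorization \<open>ys\<close> that generates the group has this property by \<open>generating_words\<close>. It passes to \<open>zs\<close>
  for the roots, and by duality, replacing roots by coroots, for the coroots.
\<close>

lemma factorization_spans_lattices:
  assumes ys: "set ys \<subseteq> affine_roots" "length ys = card simple_roots" "generated_maps (set ys) = generated_maps simple_roots"
    and zs: "set zs \<subseteq> affine_roots" "length zs = card simple_roots" "word_map zs = word_map ys"
  shows "distinct zs" "independent (set zs)" "affine_roots \<subseteq> zspan (set zs)" "acoroot ` affine_roots \<subseteq> zspan (acoroot ` set zs)"
proof -
  have "arefl x \<in> generated_maps (set ys)" if "x \<in> affine_roots" for x
    using arefl_in_generated_maps[OF that] unfolding generated_maps_affine_roots ys(3) .
  note gen = generating_words[OF ys(1) this]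
  have ay: "anisotropic (set ys)" and az: "anisotropic (set zs)" using ys(1) zs(1) by (auto intro: anisotropic_sub)
  have by': "distinct ys" "independent (set ys)" using basis_word(2)[OF gen(3) ys(2)] by auto
  have "span (set zs) = UNIV"
    by (rule independent_word_spans[OF ay az zs(3)[symmetric] by' gen(3)])
  from basis_word(2)[OF this zs(2)] show bz: "distinct zs" "independent (set zs)" by auto
  have "zspan (set ys) \<subseteq> zspan (set zs)"
  proof (rule zspan_transfer[OF ay az zs(3)[symmetric] by'])
    show "cartan x y \<in> \<int>" if "x \<in> set ys" "y \<in> set ys" for x y using that ys(1) cartan_R by blast
    show "cartan x y \<in> \<int>" if "x \<in> set zs" "y \<in> set zs" for x y using that zs(1) cartan_R by blast
    show "acoroot ` set zs \<subseteq> zspan (acoroot ` set ys)" using gen(2) zs(1) by blast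
  qed
  then show "affine_roots \<subseteq> zspan (set zs)" using gen(1) by blast
  have acoroot_map: "word_map (map acoroot vs) = word_map vs" if "set vs \<subseteq> affine_roots" for vs
    using that by (induction vs) (auto simp: arefl_acoroot fst_R simp del: comp_apply)
  have an_acoroot: "anisotropic (set (map acoroot vs))" if "set vs \<subseteq> affine_roots" for vs
    using that fst_R by (auto simp: anisotropic_def acoroot_def)
  have cartan_acoroot: "cartan x y \<in> \<int>"
    if vs: "set vs \<subseteq> affine_roots" and acoroot: "x \<in> set (map acoroot vs)" "y \<in> set (map acoroot vs)" for x y vs
  proof -
    obtain x' where x': "x' \<in> affine_roots" "x = acoroot x'" using vs acoroot(1) by auto
    obtain y' where y': "y' \<in> affine_roots" "y = acoroot y'" using vs acoroot(2) by auto
    note xy = x'(1) y'(1) x'(2) y'(2)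
    then have "cartan x y = cartan y' x'" by (simp add: cartan_def acoroot_acoroot fst_R inner_commute)
    then show ?thesis using cartan_R xy by simp
  qed
  have "zspan (set (map acoroot ys)) \<subseteq> zspan (set (map acoroot zs))"
  proof (rule zspan_transfer[OF an_acoroot[OF ys(1)] an_acoroot[OF zs(1)]])
    show "word_map (map acoroot ys) = word_map (map acoroot zs)" using acoroot_map ys(1) zs(1,3) by simp
    show "distinct (map acoroot ys)" using by'(1) inj_on_acoroot[OF ay] by (simp add: distinct_map)
    show "independent (set (map acoroot ys))" using independent_acoroot[OF ay by'(2)] by simp
    have coco: "acoroot ` acoroot ` set vs = set vs" if "set vs \<subseteq> affine_roots" for vs
    proof -
      have "(\<lambda>x. acoroot (acoroot x)) ` set vs = (\<lambda>x. x) ` set vs"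
        by (rule image_cong[OF HOL.refl]) (use that fst_R acoroot_acoroot in blast)
      then show ?thesis by (simp add: image_image)
    qed
    show "acoroot ` set (map acoroot zs) \<subseteq> zspan (acoroot ` set (map acoroot ys))"
      using coco[OF ys(1)] coco[OF zs(1)] gen(1) zs(1) by auto
  qed (use cartan_acoroot ys(1) zs(1) in blast)+
  then show "acoroot ` affine_roots \<subseteq> zspan (acoroot ` set zs)" using gen(2) by auto
qed

text \<open>
  A reduced factorization of \<open>x\<close> is an initial part of a factorization of \<open>w\<close> with as many factors
  as the rank. As \<open>x\<close> fixes a point, this initial part generates a parabolic subgroup, whose rank is
  the number of factors.
\<close>

lemma parabolic_quasi_Coxeter_if_below:
  assumes x: "x \<in> generated_maps simple_roots" "x p = p"
    and w: "quasi_Coxeter (reflection_group simple_roots) (arefl ` simple_roots) w" "absolute_le (reflection_group simple_roots) (arefl ` simple_roots) x w"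
  shows "\<exists>us J. set us \<subseteq> simple_roots \<and> J \<subset> simple_roots \<and> quasi_Coxeter (reflection_group (word_act us ` J)) (arefl ` word_act us ` J) x"
proof -
  have cS: "card (arefl ` simple_roots) = card simple_roots" using card_conj_simple[of "[]" simple_roots] by simp
  obtain ys where ys: "set ys \<subseteq> affine_roots" "word_map ys = w" "length ys = refl_length simple_roots w" "length ys = card simple_roots" "generated_maps (set ys) = generated_maps simple_roots"
    using w(1) unfolding quasi_Coxeter_reflection_group[OF anisotropic_simple_roots] root_orbit_simple_roots cS by blast
  have wW: "w \<in> generated_maps simple_roots" using generated_maps_word_map[OF ys(1)] ys(2) by (simp add: generated_maps_affine_roots)
  obtain z1 where z1: "set z1 \<subseteq> affine_roots" "word_map z1 = x" "length z1 = refl_length simple_roots x"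
    using refl_length_word[OF x(1)] unfolding root_orbit_simple_roots by metis
  define y where "y = word_map (rev z1) \<circ> w"
  have "y \<in> generated_maps simple_roots" unfolding y_def using generated_maps_word_map[of "rev z1" affine_roots] z1(1) wW by (intro generated_maps_comp) (auto simp: generated_maps_affine_roots)
  then obtain z2 where z2: "set z2 \<subseteq> affine_roots" "word_map z2 = y" "length z2 = refl_length simple_roots y"
    using refl_length_word[of y simple_roots] unfolding root_orbit_simple_roots by metis
  have len: "refl_length simple_roots x + refl_length simple_roots y = card simple_roots"
    using w(2) absolute_le_reflection_group[OF z1(1), of w] inv_mult_W[OF z1(1) wW] ys(3,4) z1(2) by (simp add: y_def)
  define zs where "zs = z1 @ z2"
  have zs: "set zs \<subseteq> affine_roots" "length zs = card simple_roots" using z1 z2 len by (auto simp: zs_def)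
  have "word_map zs = w"
    using word_map_rev'[OF anisotropic_sub[OF z1(1)]] z1(2) z2(2) by (simp add: zs_def word_map_append y_def fun_eq_iff)
  then have "word_map zs = word_map ys" using ys(2) by simp
  note lattice = factorization_spans_lattices[OF ys(1,4,5) zs this]
  have d1: "distinct z1" "independent (set z1)"
    using lattice(1,2) independent_mono[of "set zs" "set z1"] by (auto simp: zs_def)
  have a1: "anisotropic (set z1)" using z1(1) by (rule anisotropic_sub)
  have vanish: "aval z p = 0" if "z \<in> set z1" for z
    by (rule fixed_point_of_independent_word[OF a1 d1 _ that]) (simp add: z1(2) x(2))
  obtain us J where us: "set us \<subseteq> simple_roots" "J \<subset> simple_roots" "card J = card (set z1)"
      "word_act us ` J \<subseteq> root_orbit (set z1)" "set z1 \<subseteq> root_orbit (word_act us ` J)"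
  proof (rule subword_generates_parabolic[of "set zs" "set z1" p])
    show "set z1 \<subseteq> set zs" by (simp add: zs_def)
  qed (use zs(1) lattice vanish in auto)
  let ?J = "word_act us ` J"
  have JS: "J \<subseteq> simple_roots" using us(2) by auto
  have JR: "?J \<subseteq> affine_roots" by (rule conj_simple_affine_roots[OF us(1) JS])
  have aJ: "anisotropic ?J" using JR by (rule anisotropic_sub)
  have gens: "generated_maps (set z1) = generated_maps ?J"
    using generated_maps_mono[OF us(4)] generated_maps_mono[OF us(5)] generated_maps_root_orbit[OF aJ] generated_maps_root_orbit[OF a1] by blast
  have "refl_length ?J x = length z1"
  proof (rule antisym)
    show "refl_length ?J x \<le> length z1" by (rule refl_length_le[OF us(5) z1(2)])
    have "x \<in> generated_maps ?J" using generated_maps_word_map[OF order_refl, of z1] z1(2) gens by simp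
    then obtain vs where vs: "set vs \<subseteq> root_orbit ?J" "word_map vs = x" "length vs = refl_length ?J x" by (rule refl_length_word)
    then have "refl_length simple_roots x \<le> length vs" using root_orbit_R[OF JR] by (intro refl_length_le) (auto simp: root_orbit_simple_roots)
    then show "length z1 \<le> refl_length ?J x" using vs(3) z1(3) by simp
  qed
  moreover have "length z1 = card (arefl ` ?J)"
    using card_conj_simple[OF us(1) JS] us(3) distinct_card[OF d1(1)] by simp
  ultimately have "quasi_Coxeter (reflection_group ?J) (arefl ` ?J) x"
    unfolding quasi_Coxeter_reflection_group[OF aJ] using us(5) z1(2) gens by metis
  with us(1,2) show ?thesis by blast
qed

end

theorem corollary1p5:
  fixes W :: "('a::euclidean_space \<Rightarrow> 'a) monoid" and S :: "('a \<Rightarrow> 'a) set" and x :: "'a \<Rightarrow> 'a"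
  assumes "irreducible_affine_Coxeter_system W S"
    and "x \<in> carrier W"
  shows "(proper_parabolic_quasi_Coxeter W S x \<longleftrightarrow>
            (\<exists>w. quasi_Coxeter W S w \<and> absolute_le W S x w \<and> parabolic_closure W S x \<noteq> carrier W))
       \<and> (proper_parabolic_quasi_Coxeter W S x \<longleftrightarrow>
            (\<exists>w. quasi_Coxeter W S w \<and> absolute_le W S x w \<and> elliptic W x))"
proof -
  obtain \<Phi> \<Delta> \<theta> where
    ax: "crystallographic_root_system \<Phi>" "simple_system \<Phi> \<Delta>" "highest_root \<Phi> \<Delta> \<theta>"
    and WS: "W = affine_Weyl_group \<Phi>" "S = affine_simple_reflections \<Delta> \<theta>"
    using assms(1) unfolding irreducible_affine_Coxeter_system_def by blast
  interpret affine_coxeter \<Phi> \<Delta> \<theta> by unfold_locales (rule ax)+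
  have W: "W = reflection_group simple_roots" and S: "S = arefl ` simple_roots"
    by (simp_all add: WS affine_Weyl_group_eq affine_simple_reflections_eq)
  have x: "x \<in> generated_maps simple_roots" using assms(2) by (simp add: W carrier_reflection_group)
  let ?P = "\<lambda>us J. generated_maps (word_act us ` J)"
  let ?below = "\<exists>w. quasi_Coxeter W S w \<and> absolute_le W S x w"

  have pairs: "(\<exists>w\<in>generated_maps simple_roots. \<exists>I\<subseteq>arefl ` simple_roots. Q w I) \<longleftrightarrow>
    (\<exists>us J. set us \<subseteq> simple_roots \<and> J \<subseteq> simple_roots \<and> Q (word_map us) (arefl ` J))" for Q
    unfolding generated_maps_def subset_image_iff by blast
  have parabolic: "parabolic_subgroup W S P \<longleftrightarrow> (\<exists>us J. set us \<subseteq> simple_roots \<and> J \<subseteq> simple_roots \<and> P = ?P us J)" for P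
    unfolding parabolic_subgroup_def W S carrier_reflection_group pairs using parabolic_eq(1) by metis
  have ppqc: "proper_parabolic_quasi_Coxeter W S x \<longleftrightarrow>
    (\<exists>us J. set us \<subseteq> simple_roots \<and> J \<subseteq> simple_roots \<and> ?P us J \<noteq> generated_maps simple_roots \<and> quasi_Coxeter (reflection_group (word_act us ` J)) (arefl ` word_act us ` J) x)"
    unfolding proper_parabolic_quasi_Coxeter_def W S carrier_reflection_group pairs using parabolic_eq by metis
  have proper: "J \<subset> simple_roots" if "set us \<subseteq> simple_roots" "J \<subseteq> simple_roots" "?P us J \<noteq> generated_maps simple_roots" for us J
    using that generated_maps_conj_simple_roots[of us] by blast
  have improper: "?P us J \<noteq> generated_maps simple_roots" if us: "set us \<subseteq> simple_roots" and J: "J \<subset> simple_roots" for us J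
  proof
    obtain p where p: "\<forall>f\<in>?P us J. f p = p" using proper_parabolic_fixes_point[OF us J] by blast
    obtain f where "f \<in> generated_maps simple_roots" "f p \<noteq> p" by (rule W_fixes_no_point)
    moreover assume "?P us J = generated_maps simple_roots"
    ultimately show False using p by simp
  qed

  have only_if: "?below \<and> parabolic_closure W S x \<noteq> carrier W \<and> elliptic W x"
    if x_ppqc: "proper_parabolic_quasi_Coxeter W S x"
  proof -
    obtain us J where us: "set us \<subseteq> simple_roots" "J \<subseteq> simple_roots" "?P us J \<noteq> generated_maps simple_roots"
      and qc: "quasi_Coxeter (reflection_group (word_act us ` J)) (arefl ` word_act us ` J) x"
      using x_ppqc unfolding ppqc by blast
    have xP: "x \<in> ?P us J" using qc by (simp add: quasi_Coxeter_def carrier_reflection_group)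
    have "?below" using parabolic_quasi_Coxeter_extends[OF us(1,2) qc] unfolding W S by metis
    moreover have "parabolic_closure W S x \<noteq> carrier W"
    proof -
      have "parabolic_closure W S x \<subseteq> ?P us J"
        unfolding parabolic_closure_def parabolic using us xP by blast
      moreover have "?P us J \<subseteq> generated_maps simple_roots" by (rule generated_maps_subset_W[OF conj_simple_affine_roots[OF us(1,2)]])
      ultimately show ?thesis using us(3) by (auto simp: W carrier_reflection_group)
    qed
    moreover have "elliptic W x"
    proof -
      obtain p where "\<forall>f\<in>?P us J. f p = p" using proper_parabolic_fixes_point[OF us(1) proper[OF us]] ..
      then have p: "x p = p" using xP by (rule bspec)
      have "x \<in> generated_maps affine_roots" using x by (simp only: generated_maps_affine_roots)
      then obtain vs where vs: "set vs \<subseteq> affine_roots" "x = word_map vs" unfolding generated_maps_def by blast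
      obtain n where "n > 0" "x ^^ n = id" using finite_order_if_fixed_point[OF vs(1), of p] p vs(2) by metis
      then show ?thesis unfolding elliptic_def W using pow_reflection_group[OF anisotropic_simple_roots x] reflection_group_one by metis
    qed
    ultimately show ?thesis by blast
  qed
  have "if": "proper_parabolic_quasi_Coxeter W S x" if below: ?below and p: "x p = p" for p
  proof -
    obtain w where "quasi_Coxeter (reflection_group simple_roots) (arefl ` simple_roots) w" "absolute_le (reflection_group simple_roots) (arefl ` simple_roots) x w"
      using below unfolding W S by blast
    from parabolic_quasi_Coxeter_if_below[OF x p this] obtain us J where us: "set us \<subseteq> simple_roots" "J \<subset> simple_roots"
      "quasi_Coxeter (reflection_group (word_act us ` J)) (arefl ` word_act us ` J) x" by blast
    show ?thesis
      unfolding ppqc by (intro exI[of _ us] exI[of _ J] conjI us improper psubset_imp_subset[OF us(2)])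
  qed
  have closure: "\<exists>p. x p = p" if "parabolic_closure W S x \<noteq> carrier W"
  proof (rule ccontr)
    assume nofix: "\<nexists>p. x p = p"
    have whole: "P = generated_maps simple_roots" if P: "parabolic_subgroup W S P" "x \<in> P" for P
    proof (rule ccontr)
      assume ne: "P \<noteq> generated_maps simple_roots"
      obtain us J where us: "set us \<subseteq> simple_roots" "J \<subseteq> simple_roots" "P = ?P us J" using P(1) unfolding parabolic by blast
      have "J \<subset> simple_roots" using proper[OF us(1,2)] us(3) ne by simp
      from proper_parabolic_fixes_point[OF us(1) this] obtain p where "\<forall>f\<in>?P us J. f p = p" ..
      then have "x p = p" using P(2) unfolding us(3) by (rule bspec)
      with nofix show False by simp
    qed
    moreover have "parabolic_subgroup W S (generated_maps simple_roots)"
      unfolding parabolic by (intro exI[of _ "[]"] exI[of _ simple_roots]) simp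
    ultimately have "{P. parabolic_subgroup W S P \<and> x \<in> P} = {generated_maps simple_roots}" using x by blast
    then show False using that by (simp add: parabolic_closure_def W carrier_reflection_group)
  qed
  have elliptic: "\<exists>p. x p = p" if ell: "elliptic W x"
  proof -
    obtain n :: nat where n: "n > 0" "x ^^ n = id"
      using ell pow_reflection_group[OF anisotropic_simple_roots x] unfolding elliptic_def W reflection_group_one by metis
    obtain vs where "x = word_map vs" using x unfolding generated_maps_def by blast
    then show ?thesis using fixed_point_if_finite_order[of n vs] n by metis
  qed
  show ?thesis using only_if "if" closure elliptic by blast
qed

end
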